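(* There is no algorithm which, given $N,m\ge1$, a matrix $A\in\mathbb{Q}^{N\times N}$ and polynomials $P_1,\ldots,P_m\in\mathbb{Q}[x_1,\ldots,x_N]$, decides whether the loop \[ {\bf while}\ \big(P_1(X)\ge0\wedge\cdots\wedge P_m(X)\ge0\big)\ \{X:=AX\} \] terminates for every input $X\in\mathbb{Z}^N$.
   Context: The loop terminates on input $X$ if there exists $n\ge0$ such that $P_i(A^nX)<0$ for some $i$. It is terminating over $\mathbb{Z}$ if it terminates on every $X\in\mathbb{Z}^N$. *)

theory Defs
  imports
    "HOL-Library.Poly_Mapping"
    "HOL-Library.Nat_Bijection"
    "Jordan_Normal_Form.Matrix"
begin

section \<open>Linear loops with polynomial guards\<close>

text \<open>
  Polynomials with rational coefficients are finitely supported maps from monomials to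
  coefficients, a monomial being a finitely supported map from variable indices to exponents.
  The variables \<open>x\<^sub>1, \<dots>, x\<^sub>N\<close> have the indices \<open>0, \<dots>, N - 1\<close>, as do the entries of
  vectors and matrices.
\<close>

type_synonym rat_mpoly = "(nat \<Rightarrow>\<^sub>0 nat) \<Rightarrow>\<^sub>0 rat"

definition mpolys_in :: "nat \<Rightarrow> rat_mpoly set" where
  "mpolys_in N = {p. \<forall>m \<in> Poly_Mapping.keys p. Poly_Mapping.keys m \<subseteq> {..<N}}"

definition mpoly_eval :: "rat_mpoly \<Rightarrow> rat vec \<Rightarrow> rat" where
  "mpoly_eval p x =
     (\<Sum>m \<in> Poly_Mapping.keys p.
        Poly_Mapping.lookup p m * (\<Prod>i \<in> Poly_Mapping.keys m. (x $ i) ^ Poly_Mapping.lookup m i))"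

definition loop_terminates_on :: "rat mat \<Rightarrow> rat_mpoly list \<Rightarrow> rat vec \<Rightarrow> bool" where
  "loop_terminates_on A Ps X \<longleftrightarrow>
     (\<exists>n::nat. \<exists>i < length Ps. mpoly_eval (Ps ! i) ((A ^\<^sub>m n) *\<^sub>v X) < 0)"

definition loop_terminating_over_int :: "nat \<Rightarrow> rat mat \<Rightarrow> rat_mpoly list \<Rightarrow> bool" where
  "loop_terminating_over_int N A Ps \<longleftrightarrow>
     (\<forall>X :: int vec. X \<in> carrier_vec N \<longrightarrow> loop_terminates_on A Ps (map_vec rat_of_int X))"


section \<open>Algorithms\<close>

text \<open>
  Algorithms are Minsky register machines working on natural numbers. \<open>Inc r k\<close> increments
  register \<open>r\<close> and jumps to instruction \<open>k\<close>. \<open>Dec r k l\<close> jumps to \<open>l\<close> if register \<open>r\<close> is zero;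
  otherwise it decrements \<open>r\<close> and jumps to \<open>k\<close>. The machine halts when the program counter
  leaves the program. Registers are unbounded, and a program mentions only finitely many of them,
  so these machines compute exactly the partial recursive functions.
\<close>

datatype instr = Inc nat nat | Dec nat nat nat

type_synonym config = "nat \<times> (nat \<Rightarrow> nat)"

fun rm_step :: "instr list \<Rightarrow> config \<Rightarrow> config" where
  "rm_step prog (pc, s) =
     (if pc < length prog
      then (case prog ! pc of
              Inc r k \<Rightarrow> (k, s(r := Suc (s r)))
            | Dec r k l \<Rightarrow> (if s r = 0 then (l, s) else (k, s(r := s r - 1))))
      else (pc, s))"

text \<open>
  The input is in register 0, all other registers being 0 initially, and the output is in
  register 0 on halting. Configurations that have halted are fixed points of \<^const>\<open>rm_step\<close>.
\<close>

definition rm_computes :: "instr list \<Rightarrow> nat \<Rightarrow> nat \<Rightarrow> bool" where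
  "rm_computes prog x y \<longleftrightarrow>
     (\<exists>t pc s. (rm_step prog ^^ t) (0, (\<lambda>_. 0)(0 := x)) = (pc, s) \<and> length prog \<le> pc \<and> s 0 = y)"


section \<open>Presenting loops to algorithms\<close>

definition rat_encode :: "rat \<Rightarrow> nat" where
  "rat_encode q = (case quotient_of q of (a, b) \<Rightarrow> prod_encode (int_encode a, int_encode b))"

definition mat_encode :: "rat mat \<Rightarrow> nat" where
  "mat_encode A = list_encode (map (\<lambda>row. list_encode (map rat_encode row)) (mat_to_list A))"

definition mono_encode :: "nat \<Rightarrow> (nat \<Rightarrow>\<^sub>0 nat) \<Rightarrow> nat" where
  "mono_encode N m = list_encode (map (Poly_Mapping.lookup m) [0..<N])"

text \<open>
  A polynomial is presented as its list of nonzero terms; \<^const>\<open>Poly_Mapping.items\<close> lists them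
  in increasing order of monomials.
\<close>

definition mpoly_encode :: "nat \<Rightarrow> rat_mpoly \<Rightarrow> nat" where
  "mpoly_encode N p =
     list_encode (map (\<lambda>(m, c). prod_encode (rat_encode c, mono_encode N m)) (Poly_Mapping.items p))"

definition loop_encode :: "nat \<Rightarrow> rat mat \<Rightarrow> rat_mpoly list \<Rightarrow> nat" where
  "loop_encode N A Ps =
     prod_encode (N, prod_encode (mat_encode A, list_encode (map (mpoly_encode N) Ps)))"

lemma rat_encode_inj: "rat_encode a = rat_encode b \<Longrightarrow> a = b"
proof -
  assume "rat_encode a = rat_encode b"
  hence "quotient_of a = quotient_of b"
    using inj_int_encode[of UNIV]
    by (auto simp: rat_encode_def inj_def split: prod.splits)
  thus "a = b"
    by (rule quotient_of_inject)
qed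

lemma list_encode_map_inj:
  assumes "list_encode (map f xs) = list_encode (map f ys)"
    and "\<And>x y. x \<in> set xs \<Longrightarrow> y \<in> set ys \<Longrightarrow> f x = f y \<Longrightarrow> x = y"
  shows "xs = ys"
  using assms by (metis list.inj_map_strong list_encode_eq)

lemma mat_encode_inj:
  assumes "A \<in> carrier_mat N N" "B \<in> carrier_mat N N" "mat_encode A = mat_encode B"
  shows "A = B"
proof -
  have "mat_to_list A = mat_to_list B"
    using assms(3) unfolding mat_encode_def
    by (rule list_encode_map_inj) (erule list_encode_map_inj, erule rat_encode_inj)
  hence "A $$ (i, j) = B $$ (i, j)" if "i < N" "j < N" for i j
    using assms(1,2) that unfolding mat_to_list_def by auto
  thus ?thesis
    using assms(1,2) by (intro eq_matI) auto
qed

lemma mono_encode_inj: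
  assumes "Poly_Mapping.keys a \<subseteq> {..<N}" "Poly_Mapping.keys b \<subseteq> {..<N}"
    and "mono_encode N a = mono_encode N b"
  shows "a = b"
proof (rule poly_mapping_eqI)
  fix i
  have "Poly_Mapping.lookup a i = Poly_Mapping.lookup b i" if "i < N"
    using assms(3) that by (auto simp: mono_encode_def list_encode_eq)
  moreover have "Poly_Mapping.lookup a i = Poly_Mapping.lookup b i" if "\<not> i < N"
  proof -
    have "i \<notin> Poly_Mapping.keys a" "i \<notin> Poly_Mapping.keys b"
      using assms(1,2) that by auto
    thus ?thesis by (simp add: in_keys_iff)
  qed
  ultimately show "Poly_Mapping.lookup a i = Poly_Mapping.lookup b i" by blast
qed

lemma mpoly_encode_inj:
  assumes "p \<in> mpolys_in N" "q \<in> mpolys_in N" "mpoly_encode N p = mpoly_encode N q"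
  shows "p = q"
proof -
  have "Poly_Mapping.items p = Poly_Mapping.items q"
    using assms(3) unfolding mpoly_encode_def
  proof (rule list_encode_map_inj)
    fix x y :: "(nat \<Rightarrow>\<^sub>0 nat) \<times> rat"
    assume x: "x \<in> set (Poly_Mapping.items p)" and y: "y \<in> set (Poly_Mapping.items q)"
      and eq: "(\<lambda>(m, c). prod_encode (rat_encode c, mono_encode N m)) x =
               (\<lambda>(m, c). prod_encode (rat_encode c, mono_encode N m)) y"
    have "fst x \<in> Poly_Mapping.keys p" "fst y \<in> Poly_Mapping.keys q"
      using x y by (auto simp: items_def)
    hence "Poly_Mapping.keys (fst x) \<subseteq> {..<N}" "Poly_Mapping.keys (fst y) \<subseteq> {..<N}"
      using assms(1,2) by (auto simp: mpolys_in_def)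
    thus "x = y"
      using eq mono_encode_inj rat_encode_inj by (auto simp: prod_eq_iff split: prod.splits)
  qed
  thus ?thesis by (metis the_value_items)
qed

lemma loop_encode_inj:
  assumes "A \<in> carrier_mat N N" "set Ps \<subseteq> mpolys_in N"
    and "B \<in> carrier_mat M M" "set Qs \<subseteq> mpolys_in M"
    and "loop_encode N A Ps = loop_encode M B Qs"
  shows "N = M \<and> A = B \<and> Ps = Qs"
proof -
  have eq: "N = M" "mat_encode A = mat_encode B"
    "list_encode (map (mpoly_encode N) Ps) = list_encode (map (mpoly_encode M) Qs)"
    using assms(5) by (auto simp: loop_encode_def)
  have "Ps = Qs"
    using eq(3) unfolding \<open>N = M\<close>
    by (rule list_encode_map_inj) (use assms(2,4) eq(1) mpoly_encode_inj in blast)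
  thus ?thesis
    using eq assms(1,3) mat_encode_inj by blast
qed

end

theory Submission
  imports Defs
begin

text \<open>
  The inputs for which the loop runs forever are those \<open>X\<close> with \<open>P\<^sub>i (A\<^sup>n X) \<ge> 0\<close> for all \<open>n\<close> and
  \<open>i\<close>, an \<open>\<exists>\<forall>\<close> condition. The universally quantified \<open>n\<close> makes exponentiation available: if the
  coordinates of \<open>X\<close> include a counter and its power of two, then \<open>b = 2\<^sup>a\<close> says that for all
  \<open>n\<close>, \<open>n = a\<close> implies \<open>b = 2\<^sup>n\<close>, and \<open>(b - 2\<^sup>n)\<^sup>2 ((n - a)\<^sup>2 - 1) \<ge> 0\<close> expresses this by a polynomial
  guard. The set of non-terminating inputs of a loop with an integral matrix is closed under \<open>A\<close>, so
  that the counter could not be forced to start at 0; a coordinate that is halved in every step and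
  the integrality of \<open>X\<close> achieve this.

  Exponential Diophantine equations express that a register machine halts. Following Jones and
  Matiyasevich, the history of the run is coded by the digits, in a base that is a power of two, of
  finitely many numbers; that the digits of a number are bounded by those of another one is expressed
  by the parity of a binomial coefficient, by Lucas' theorem.

  The reduction is diagonalised without a universal machine. The input \<open>x\<close> of the machine
  enters the loop only as the matrix entry \<open>(0, 0)\<close>. The machine reads its input \<open>x\<close> as the code
  of the remaining part of a loop, inserts \<open>x\<close> itself as that entry, asks the supposed decision
  procedure about the resulting loop, and halts iff that loop terminates.
\<close>

section \<open>Polynomials and the orbit of the loop\<close>

text \<open>Valuations are total functions here, so that the algebra of evaluation needs no
  dimension; \<open>poly_at_cong\<close> leads back to finitely many coordinates.\<close>

definition poly_at :: "rat_mpoly \<Rightarrow> (nat \<Rightarrow> rat) \<Rightarrow> rat" where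
  "poly_at p y = (\<Sum>m \<in> Poly_Mapping.keys p. Poly_Mapping.lookup p m *
     (\<Prod>i \<in> Poly_Mapping.keys m. y i ^ Poly_Mapping.lookup m i))"

lemma mpoly_eval_eq_poly_at: "mpoly_eval p x = poly_at p (($) x)"
  by (simp add: mpoly_eval_def poly_at_def)

lemma poly_at_superset:
  assumes "finite S" "Poly_Mapping.keys p \<subseteq> S"
  shows "poly_at p y = (\<Sum>m \<in> S. Poly_Mapping.lookup p m *
     (\<Prod>i \<in> Poly_Mapping.keys m. y i ^ Poly_Mapping.lookup m i))"
  unfolding poly_at_def
  by (rule sum.mono_neutral_left) (use assms in \<open>auto simp: in_keys_iff\<close>)

lemma poly_at_add: "poly_at (p + q) y = poly_at p y + poly_at q y"
proof -
  let ?S = "Poly_Mapping.keys p \<union> Poly_Mapping.keys q"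
  have "finite ?S" "Poly_Mapping.keys (p + q) \<subseteq> ?S"
    by (simp_all add: Poly_Mapping.keys_add)
  then show ?thesis
    by (simp add: poly_at_superset[of ?S] lookup_add sum.distrib distrib_right)
qed

lemma poly_at_zero [simp]: "poly_at 0 y = 0"
  by (simp add: poly_at_def)

lemma poly_at_single:
  "poly_at (Poly_Mapping.single m c) y =
     c * (\<Prod>i \<in> Poly_Mapping.keys m. y i ^ Poly_Mapping.lookup m i)"
  by (simp add: poly_at_def)

lemma poly_at_sum: "poly_at (sum f I) y = (\<Sum>i\<in>I. poly_at (f i) y)"
  by (induction I rule: infinite_finite_induct) (simp_all add: poly_at_add)

text \<open>On the union of both supports the missing exponents are 0 and contribute the factor 1,
  so exponents can be added pointwise.\<close>

lemma monomial_add: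
  fixes m n :: "nat \<Rightarrow>\<^sub>0 nat" and y :: "nat \<Rightarrow> rat"
  shows "(\<Prod>i \<in> Poly_Mapping.keys (m + n). y i ^ Poly_Mapping.lookup (m + n) i) =
    (\<Prod>i \<in> Poly_Mapping.keys m. y i ^ Poly_Mapping.lookup m i) *
    (\<Prod>i \<in> Poly_Mapping.keys n. y i ^ Poly_Mapping.lookup n i)"
proof -
  let ?S = "Poly_Mapping.keys m \<union> Poly_Mapping.keys n"
  have ext: "(\<Prod>i \<in> Poly_Mapping.keys k. y i ^ Poly_Mapping.lookup k i) =
      (\<Prod>i \<in> ?S. y i ^ Poly_Mapping.lookup k i)" if "Poly_Mapping.keys k \<subseteq> ?S" for k
    by (rule prod.mono_neutral_left) (use that in \<open>auto simp: in_keys_iff\<close>)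
  show ?thesis
    unfolding ext[OF Poly_Mapping.keys_add] ext[OF Un_upper1] ext[OF Un_upper2]
    by (simp only: lookup_add power_add prod.distrib)
qed

lemma poly_mapping_sum_single:
  "p = (\<Sum>m \<in> Poly_Mapping.keys p. Poly_Mapping.single m (Poly_Mapping.lookup p m))"
proof (rule poly_mapping_eqI)
  fix k
  show "Poly_Mapping.lookup p k = Poly_Mapping.lookup
      (\<Sum>m \<in> Poly_Mapping.keys p. Poly_Mapping.single m (Poly_Mapping.lookup p m)) k"
    by (simp add: lookup_sum lookup_single when_def in_keys_iff)
qed

text \<open>Splitting both factors into terms reduces the claim to products of single terms, where
  it is \<open>monomial_add\<close>.\<close>

lemma poly_at_mult: "poly_at (p * q) y = poly_at p y * poly_at q y"
proof -
  let ?s = "\<lambda>p m. Poly_Mapping.single m (Poly_Mapping.lookup p m) :: rat_mpoly"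
  have "p * q = (\<Sum>m \<in> Poly_Mapping.keys p. ?s p m) * (\<Sum>n \<in> Poly_Mapping.keys q. ?s q n)"
    by (rule arg_cong2[OF poly_mapping_sum_single poly_mapping_sum_single])
  also have "\<dots> = (\<Sum>m \<in> Poly_Mapping.keys p. \<Sum>n \<in> Poly_Mapping.keys q. ?s p m * ?s q n)"
    by (rule sum_product)
  finally have "poly_at (p * q) y =
      (\<Sum>m \<in> Poly_Mapping.keys p. \<Sum>n \<in> Poly_Mapping.keys q.
         poly_at (?s p m) y * poly_at (?s q n) y)"
    by (simp add: poly_at_sum mult_single poly_at_single monomial_add mult_ac)
  also have "\<dots> = (\<Sum>m \<in> Poly_Mapping.keys p. poly_at (?s p m) y) *
      (\<Sum>n \<in> Poly_Mapping.keys q. poly_at (?s q n) y)"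
    by (rule sum_product[symmetric])
  also have "\<dots> = poly_at p y * poly_at q y"
    by (simp only: poly_at_sum[symmetric] poly_mapping_sum_single[symmetric])
  finally show ?thesis .
qed

definition const :: "int \<Rightarrow> rat_mpoly" where
  "const c = Poly_Mapping.single 0 (of_int c)"

definition var :: "nat \<Rightarrow> rat_mpoly" where
  "var i = Poly_Mapping.single (Poly_Mapping.single i 1) 1"

lemma poly_at_const [simp]: "poly_at (const c) y = of_int c"
  by (simp add: const_def poly_at_single del: single_of_int)

lemma poly_at_var [simp]: "poly_at (var i) y = y i"
  by (simp add: var_def poly_at_single)

lemma poly_at_uminus: "poly_at (- p) y = - poly_at p y"
  using poly_at_add[of "- p" p y] by simp

lemma poly_at_diff: "poly_at (p - q) y = poly_at p y - poly_at q y"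
  using poly_at_add[of p "- q" y] by (simp add: poly_at_uminus)

lemmas poly_at_simps = poly_at_add poly_at_mult poly_at_diff poly_at_uminus poly_at_sum

lemma poly_at_cong:
  assumes "p \<in> mpolys_in N" "\<And>i. i < N \<Longrightarrow> y i = z i"
  shows "poly_at p y = poly_at p z"
  unfolding poly_at_def
  by (intro sum.cong prod.cong refl arg_cong2[of _ _ _ _ "(*)"] arg_cong2[of _ _ _ _ "(^)"])
     (use assms in \<open>auto simp: mpolys_in_def\<close>)

section \<open>Polynomials in a bounded set of variables\<close>

lemma mpolys_in_mono: "p \<in> mpolys_in M \<Longrightarrow> M \<le> N \<Longrightarrow> p \<in> mpolys_in N"
  by (fastforce simp: mpolys_in_def)

lemma mpolys_in_const [simp]: "const c \<in> mpolys_in N"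
  by (auto simp: mpolys_in_def const_def simp del: single_of_int split: if_splits)

lemma mpolys_in_var [simp]: "i < N \<Longrightarrow> var i \<in> mpolys_in N"
  by (auto simp: mpolys_in_def var_def split: if_splits)

lemma mpolys_in_add [simp]: "p \<in> mpolys_in N \<Longrightarrow> q \<in> mpolys_in N \<Longrightarrow> p + q \<in> mpolys_in N"
  using Poly_Mapping.keys_add[of p q] by (auto simp: mpolys_in_def)

lemma mpolys_in_diff [simp]: "p \<in> mpolys_in N \<Longrightarrow> q \<in> mpolys_in N \<Longrightarrow> p - q \<in> mpolys_in N"
proof -
  assume "p \<in> mpolys_in N" "q \<in> mpolys_in N"
  moreover have "Poly_Mapping.keys (p - q) \<subseteq> Poly_Mapping.keys p \<union> Poly_Mapping.keys q"
    by (auto simp: in_keys_iff lookup_minus)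
  ultimately show ?thesis by (auto simp: mpolys_in_def)
qed

lemma mpolys_in_mult [simp]:
  assumes "p \<in> mpolys_in N" "q \<in> mpolys_in N" shows "p * q \<in> mpolys_in N"
proof -
  have "Poly_Mapping.keys m \<subseteq> {..<N}" if m: "m \<in> Poly_Mapping.keys (p * q)" for m
  proof -
    obtain a b where "m = a + b" "a \<in> Poly_Mapping.keys p" "b \<in> Poly_Mapping.keys q"
      using m Poly_Mapping.keys_mult[of p q] by auto
    then show ?thesis
      using assms Poly_Mapping.keys_add[of a b] by (fastforce simp: mpolys_in_def)
  qed
  then show ?thesis by (auto simp: mpolys_in_def)
qed

text \<open>
  Started in \<open>(1, 1, 0, 1, 1, v)\<close>, the loop reaches \<open>(x\<^sup>n, 1, n, 2\<^sup>n, 1 / 2\<^sup>n, v)\<close> after \<open>n\<close> steps.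
\<close>

definition loop_mat :: "nat \<Rightarrow> nat \<Rightarrow> rat mat" where
  "loop_mat N x = mat N N (\<lambda>(i, j).
     (if i = j then if i = 0 then of_nat x else if i = 3 then 2 else if i = 4 then 1 / 2 else 1 else 0) +
     (if i = 2 \<and> j = 1 then 1 else 0))"

definition orbit :: "nat \<Rightarrow> nat \<Rightarrow> (nat \<Rightarrow> rat) \<Rightarrow> nat \<Rightarrow> rat" where
  "orbit x n Y i =
     (if i = 0 then of_nat x ^ n * Y 0 else if i = 2 then Y 2 + of_nat n * Y 1
      else if i = 3 then 2 ^ n * Y 3 else if i = 4 then Y 4 / 2 ^ n else Y i)"

lemma loop_mat_carrier [simp]: "loop_mat N x \<in> carrier_mat N N"
  by (simp add: loop_mat_def)

lemma loop_mat_step: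
  assumes "Y \<in> carrier_vec N" "N > 1"
  shows "loop_mat N x *\<^sub>v Y = vec N (orbit x 1 (($) Y))"
proof (rule eq_vecI)
  fix i assume i: "i < dim_vec (vec N (orbit x 1 (($) Y)))"
  define d :: rat where "d = (if i = 0 then of_nat x else if i = 3 then 2 else if i = 4 then 1 / 2 else 1)"
  have "(loop_mat N x *\<^sub>v Y) $ i = (\<Sum>j\<in>{0..<N}.
     ((if i = j then d else 0) + (if i = 2 \<and> j = 1 then 1 else 0)) * Y $ j)"
    using assms i by (auto simp: loop_mat_def scalar_prod_def d_def intro!: sum.cong)
  also have "\<dots> = (\<Sum>j\<in>{0..<N}. (if i = j then d * Y $ j else 0) +
     (if j = 1 then if i = 2 then Y $ 1 else 0 else 0))"
    by (intro sum.cong) (auto simp: algebra_simps)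
  also have "\<dots> = vec N (orbit x 1 (($) Y)) $ i"
    unfolding sum.distrib using i assms by (auto simp: orbit_def d_def)
  finally show "(loop_mat N x *\<^sub>v Y) $ i = vec N (orbit x 1 (($) Y)) $ i" .
qed (auto simp: loop_mat_def)

lemma loop_mat_pow:
  assumes "Y \<in> carrier_vec N" "N > 2"
  shows "(loop_mat N x ^\<^sub>m n) *\<^sub>v Y = vec N (orbit x n (($) Y))"
  using assms(1)
proof (induction n arbitrary: Y)
  case 0
  then show ?case by (auto simp: orbit_def loop_mat_def intro!: eq_vecI)
next
  case (Suc n)
  let ?Z = "vec N (orbit x 1 (($) Y))"
  have "(loop_mat N x ^\<^sub>m Suc n) *\<^sub>v Y = (loop_mat N x ^\<^sub>m n) *\<^sub>v (loop_mat N x *\<^sub>v Y)"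
    using Suc.prems by (simp add: assoc_mult_mat_vec[OF pow_carrier_mat[OF loop_mat_carrier] loop_mat_carrier])
  also have "\<dots> = vec N (orbit x n (($) ?Z))"
    using Suc assms(2) by (simp add: loop_mat_step)
  also have "\<dots> = vec N (orbit x (Suc n) (($) Y))"
    using assms(2) by (intro eq_vecI) (auto simp: orbit_def algebra_simps)
  finally show ?case .
qed

section \<open>Guards that force the initial state on integer inputs\<close>

definition start :: "(nat \<Rightarrow> int) \<Rightarrow> nat \<Rightarrow> int" where
  "start v i = (if i = 2 then 0 else if i < 5 then 1 else v (i - 5))"

definition state :: "nat \<Rightarrow> nat \<Rightarrow> (nat \<Rightarrow> int) \<Rightarrow> nat \<Rightarrow> rat" where
  "state x n v = orbit x n (\<lambda>i. of_int (start v i))"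

lemma state_simps:
  "state x n v 0 = of_nat x ^ n" "state x n v (Suc 0) = 1" "state x n v 2 = of_nat n"
  "state x n v 3 = 2 ^ n" "state x n v 4 = 1 / 2 ^ n" "state x n v (5 + i) = of_int (v i)"
  by (simp_all add: state_def orbit_def start_def)

definition start_guards :: "rat_mpoly list" where
  "start_guards = [var 1 - const 1, const 1 - var 1, var 3 * var 4 - const 1, const 1 - var 3 * var 4,
     var 3, var 2, const 1 - var 4 * (const 1 + var 2),
     (var 0 - const 1) * (var 0 - const 1) * (var 2 * var 2 - const 1)]"

lemma start_guards_in: "N \<ge> 5 \<Longrightarrow> set start_guards \<subseteq> mpolys_in N"
  by (auto simp: start_guards_def)

text \<open>The guard with \<open>const 1 + var 2\<close> holds since
  \<open>1 + n \<le> 2 ^ n\<close>. The last one holds since coordinate 0 is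
  \<open>x ^ 0 = 1\<close> at time 0 and \<open>n * n \<ge> 1\<close> afterwards.\<close>

lemma start_guards_state:
  assumes "p \<in> set start_guards" shows "poly_at p (state x n v) \<ge> 0"
proof -
  have "Suc n \<le> 2 ^ n" by (metis less_exp Suc_leI)
  then have "rat_of_nat (Suc n) \<le> rat_of_nat (2 ^ n)" by (simp only: of_nat_le_iff)
  then have a: "1 + rat_of_nat n \<le> 2 ^ n" by simp
  then have "1 / 2 ^ n * (1 + rat_of_nat n) \<le> 1" by (simp add: divide_simps)
  moreover
  have "n = 0 \<or> rat_of_nat n * rat_of_nat n \<ge> 1"
    by (cases n) (auto simp: algebra_simps)
  then have "(rat_of_nat x ^ n - 1) * (rat_of_nat x ^ n - 1) * (rat_of_nat n * rat_of_nat n - 1) \<ge> 0"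
    by auto
  ultimately show ?thesis
    using assms by (auto simp: start_guards_def poly_at_simps state_simps)
qed

text \<open>Over the integers \<open>X 3 * X 4 = 1\<close> with \<open>X 3 \<ge> 0\<close> leaves
  only 1 for both factors. Then \<open>X 2 = 0\<close>, and this makes the last guard force
  \<open>X 0 = 1\<close>. Later states of the orbit satisfy the same guards but have a proper
  fraction as coordinate 4.\<close>

lemma start_guards_force:
  fixes X :: "nat \<Rightarrow> int"
  assumes "\<And>p. p \<in> set start_guards \<Longrightarrow> poly_at p (\<lambda>i. of_int (X i)) \<ge> 0"
  shows "X i = start (\<lambda>j. X (5 + j)) i"
proof -
  have all: "\<forall>p\<in>set start_guards. poly_at p (\<lambda>i. of_int (X i)) \<ge> 0"
    using assms by blast
  have "rat_of_int 1 \<le> rat_of_int (X 1)" "rat_of_int (X 1) \<le> rat_of_int 1"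
    "rat_of_int 1 \<le> rat_of_int (X 3 * X 4)" "rat_of_int (X 3 * X 4) \<le> rat_of_int 1"
    "rat_of_int 0 \<le> rat_of_int (X 3)" "rat_of_int 0 \<le> rat_of_int (X 2)"
    "rat_of_int (X 4 * (1 + X 2)) \<le> rat_of_int 1"
    "rat_of_int 0 \<le> rat_of_int ((X 0 - 1) * (X 0 - 1) * (X 2 * X 2 - 1))"
    using all by (simp_all add: start_guards_def poly_at_simps)
  note ge = this[unfolded of_int_le_iff]
  then have X1: "X 1 = 1" and X34: "X 3 * X 4 = 1"
    by linarith+
  with ge have X3: "X 3 = 1" and X4: "X 4 = 1" by (auto simp: zmult_eq_1_iff)
  with ge have X2: "X 2 = 0" by simp
  with ge have "(X 0 - 1) * (X 0 - 1) \<le> 0" by simp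
  then have X0: "X 0 = 1"
    using zero_le_square[of "X 0 - 1"] by (metis antisym eq_iff_diff_eq_0 mult_eq_0_iff)
  consider "i = 0" | "i = 1" | "i = 2" | "i = 3" | "i = 4" | "i \<ge> 5" by linarith
  then show ?thesis
    by cases (use X0 X1 X2 X3 X4 in \<open>simp_all add: start_def\<close>)
qed

text \<open>One list of guards has to serve all \<open>x\<close> and \<open>v\<close>: the input
  \<open>x\<close> acts only through the matrix, as the diagonal argument demands. The first five
  coordinates are reserved for the control part of the loop, hence \<open>5 + K\<close>.\<close>

definition checkable :: "nat \<Rightarrow> (nat \<Rightarrow> (nat \<Rightarrow> int) \<Rightarrow> bool) \<Rightarrow> bool" where
  "checkable K Q \<longleftrightarrow> (\<exists>Ps. set Ps \<subseteq> mpolys_in (5 + K) \<and>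
     (\<forall>x v. Q x v \<longleftrightarrow> (\<forall>n. \<forall>p \<in> set Ps. poly_at p (state x n v) \<ge> 0)))"

text \<open>At time 0 the start guards give every non-terminating integer input the form
  \<open>start v\<close>; for such an input the remaining guards hold at all times iff
  \<open>Q x v\<close>.\<close>

theorem checkable_loop:
  assumes "checkable K Q"
  obtains Ps where "length Ps \<ge> 1" "set Ps \<subseteq> mpolys_in (5 + K)"
    "\<And>x. loop_terminating_over_int (5 + K) (loop_mat (5 + K) x) Ps \<longleftrightarrow> \<not> (\<exists>v. Q x v)"
proof -
  obtain Qs where Qs: "set Qs \<subseteq> mpolys_in (5 + K)"
    and Q: "\<And>x v. Q x v \<longleftrightarrow> (\<forall>n. \<forall>p \<in> set Qs. poly_at p (state x n v) \<ge> 0)"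
    using assms by (auto simp: checkable_def)
  let ?N = "5 + K"
  let ?Ps = "start_guards @ Qs"
  have Ps: "set ?Ps \<subseteq> mpolys_in ?N"
    using Qs start_guards_in[of ?N] by auto
  have run: "loop_terminates_on (loop_mat ?N x) ?Ps (map_vec rat_of_int X) \<longleftrightarrow>
      \<not> (\<forall>n. \<forall>p \<in> set ?Ps. poly_at p (orbit x n (\<lambda>i. of_int (X $ i))) \<ge> 0)"
    if X: "X \<in> carrier_vec ?N" for x X
  proof -
    have "mpoly_eval p ((loop_mat ?N x ^\<^sub>m n) *\<^sub>v map_vec rat_of_int X) =
        poly_at p (orbit x n (\<lambda>i. of_int (X $ i)))" if "p \<in> set ?Ps" for p n
    proof -
      have "(loop_mat ?N x ^\<^sub>m n) *\<^sub>v map_vec rat_of_int X = vec ?N (orbit x n (($) (map_vec rat_of_int X)))"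
        using X by (intro loop_mat_pow) auto
      then show ?thesis
        unfolding mpoly_eval_eq_poly_at
        by (intro poly_at_cong[of _ ?N]) (use that Ps X in \<open>auto simp: orbit_def\<close>)
    qed
    then show ?thesis
      unfolding loop_terminates_on_def by (metis in_set_conv_nth not_le)
  qed
  have "(\<exists>X :: int vec. X \<in> carrier_vec ?N \<and>
      (\<forall>n. \<forall>p \<in> set ?Ps. poly_at p (orbit x n (\<lambda>i. of_int (X $ i))) \<ge> 0)) \<longleftrightarrow> (\<exists>v. Q x v)" for x
  proof
    assume "\<exists>X :: int vec. X \<in> carrier_vec ?N \<and>
      (\<forall>n. \<forall>p \<in> set ?Ps. poly_at p (orbit x n (\<lambda>i. of_int (X $ i))) \<ge> 0)"
    then obtain X :: "int vec" where X: "\<And>n p. p \<in> set ?Ps \<Longrightarrow> poly_at p (orbit x n (\<lambda>i. of_int (X $ i))) \<ge> 0"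
      by blast
    have "orbit x 0 Y = Y" for Y by (auto simp: orbit_def)
    with X[of _ 0] have st: "X $ i = start (\<lambda>j. X $ (5 + j)) i" for i
      by (intro start_guards_force) auto
    then have "state x n (\<lambda>j. X $ (5 + j)) = orbit x n (\<lambda>i. of_int (X $ i))" for n
      unfolding state_def by (simp only: st[symmetric])
    with X have "Q x (\<lambda>j. X $ (5 + j))" by (auto simp: Q)
    then show "\<exists>v. Q x v" by blast
  next
    assume "\<exists>v. Q x v"
    then obtain v where v: "Q x v" by blast
    let ?X = "vec ?N (start v)"
    have "poly_at p (orbit x n (\<lambda>i. of_int (?X $ i))) = poly_at p (state x n v)" if "p \<in> set ?Ps" for p n
      by (intro poly_at_cong[of _ ?N]) (use that Ps in \<open>auto simp: orbit_def state_def\<close>)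
    then have "\<forall>n. \<forall>p \<in> set ?Ps. poly_at p (orbit x n (\<lambda>i. of_int (?X $ i))) \<ge> 0"
      using v start_guards_state by (auto simp: Q)
    then show "\<exists>X :: int vec. X \<in> carrier_vec ?N \<and>
      (\<forall>n. \<forall>p \<in> set ?Ps. poly_at p (orbit x n (\<lambda>i. of_int (X $ i))) \<ge> 0)"
      by (intro exI[of _ ?X]) simp
  qed
  then have "loop_terminating_over_int ?N (loop_mat ?N x) ?Ps \<longleftrightarrow> \<not> (\<exists>v. Q x v)" for x
    unfolding loop_terminating_over_int_def using run by blast
  with Ps show thesis by (intro that[of ?Ps]) (simp_all add: start_guards_def)
qed

section \<open>Conditions expressible by loops\<close>

lemma state_cong:
  assumes "\<And>i. i < K \<Longrightarrow> v i = w i" "j < 5 + K"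
  shows "state x n v j = state x n w j"
  using assms by (auto simp: state_def orbit_def start_def)

lemma checkable_mono: "checkable K Q \<Longrightarrow> K \<le> M \<Longrightarrow> checkable M Q"
  unfolding checkable_def by (meson add_left_mono mpolys_in_mono subset_iff)

lemma checkable_local:
  assumes "checkable K Q" "\<And>i. i < K \<Longrightarrow> v i = w i"
  shows "Q x v \<longleftrightarrow> Q x w"
proof -
  obtain Ps where Ps: "set Ps \<subseteq> mpolys_in (5 + K)"
    and Q: "\<And>x v. Q x v \<longleftrightarrow> (\<forall>n. \<forall>p \<in> set Ps. poly_at p (state x n v) \<ge> 0)"
    using assms(1) by (auto simp: checkable_def)
  have "poly_at p (state x n v) = poly_at p (state x n w)" if "p \<in> set Ps" for p n
    by (rule poly_at_cong[of _ "5 + K"]) (use that Ps assms(2) in \<open>auto intro: state_cong\<close>)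
  then show ?thesis by (auto simp: Q)
qed

lemma checkable_conj:
  assumes "checkable K P" "checkable K Q"
  shows "checkable K (\<lambda>x v. P x v \<and> Q x v)"
proof -
  obtain Ps where Ps: "set Ps \<subseteq> mpolys_in (5 + K)"
    and P: "\<And>x v. P x v \<longleftrightarrow> (\<forall>n. \<forall>p \<in> set Ps. poly_at p (state x n v) \<ge> 0)"
    using assms(1) by (auto simp: checkable_def)
  obtain Qs where Qs: "set Qs \<subseteq> mpolys_in (5 + K)"
    and Q: "\<And>x v. Q x v \<longleftrightarrow> (\<forall>n. \<forall>p \<in> set Qs. poly_at p (state x n v) \<ge> 0)"
    using assms(2) by (auto simp: checkable_def)
  show ?thesis
    unfolding checkable_def by (rule exI[of _ "Ps @ Qs"]) (use Ps Qs P Q in auto)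
qed

lemma checkable_True: "checkable K (\<lambda>x v. True)"
  unfolding checkable_def by (rule exI[of _ "[]"]) simp

text \<open>The value must be the same at all times \<open>n\<close> and for all \<open>x\<close>,
  so that it is a function of the parameters alone.\<close>

definition int_poly :: "nat \<Rightarrow> ((nat \<Rightarrow> int) \<Rightarrow> int) \<Rightarrow> bool" where
  "int_poly K f \<longleftrightarrow> (\<exists>p \<in> mpolys_in (5 + K). \<forall>x n v. poly_at p (state x n v) = of_int (f v))"

lemma int_poly_mono: "int_poly K f \<Longrightarrow> K \<le> M \<Longrightarrow> int_poly M f"
  unfolding int_poly_def by (meson add_left_mono mpolys_in_mono)

lemma int_poly_local:
  assumes "int_poly K f" "\<And>i. i < K \<Longrightarrow> v i = w i"
  shows "f v = f w"
proof -
  obtain p where p: "p \<in> mpolys_in (5 + K)" "\<And>x n v. poly_at p (state x n v) = of_int (f v)"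
    using assms(1) unfolding int_poly_def by blast
  have "poly_at p (state 0 0 v) = poly_at p (state 0 0 w)"
    by (rule poly_at_cong[OF p(1)]) (use assms(2) in \<open>auto intro: state_cong\<close>)
  then show ?thesis by (simp add: p(2))
qed

lemma int_poly_var: "i < K \<Longrightarrow> int_poly K (\<lambda>v. v i)"
  unfolding int_poly_def by (rule bexI[of _ "var (5 + i)"]) (simp_all add: state_simps)

lemma int_poly_const: "int_poly K (\<lambda>v. c)"
  unfolding int_poly_def by (rule bexI[of _ "const c"]) simp_all

lemma int_poly_add: "int_poly K f \<Longrightarrow> int_poly K g \<Longrightarrow> int_poly K (\<lambda>v. f v + g v)"
  unfolding int_poly_def
  by (elim bexE, rule_tac x = "p + pa" in bexI) (simp_all add: poly_at_simps)

lemma int_poly_diff: "int_poly K f \<Longrightarrow> int_poly K g \<Longrightarrow> int_poly K (\<lambda>v. f v - g v)"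
  unfolding int_poly_def
  by (elim bexE, rule_tac x = "p - pa" in bexI) (simp_all add: poly_at_simps)

lemma int_poly_mult: "int_poly K f \<Longrightarrow> int_poly K g \<Longrightarrow> int_poly K (\<lambda>v. f v * g v)"
  unfolding int_poly_def
  by (elim bexE, rule_tac x = "p * pa" in bexI) (simp_all add: poly_at_simps)

lemma int_poly_sum:
  fixes I :: "nat set"
  shows "(\<And>i. i \<in> I \<Longrightarrow> int_poly K (f i)) \<Longrightarrow> int_poly K (\<lambda>v. \<Sum>i\<in>I. f i v)"
  by (induction I rule: infinite_finite_induct) (simp_all add: int_poly_const int_poly_add)

lemmas int_poly_intros =
  int_poly_var int_poly_const int_poly_add int_poly_diff int_poly_mult int_poly_sum

section \<open>Comparisons, powers of two and the input as guards\<close>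

lemma checkable_nonneg:
  assumes "int_poly K f" shows "checkable K (\<lambda>x v. f v \<ge> 0)"
proof -
  obtain p where p: "p \<in> mpolys_in (5 + K)" "\<And>x n v. poly_at p (state x n v) = of_int (f v)"
    using assms unfolding int_poly_def by blast
  show ?thesis
    unfolding checkable_def by (rule exI[of _ "[p]"]) (simp add: p)
qed

lemma checkable_le:
  assumes "int_poly K f" "int_poly K g" shows "checkable K (\<lambda>x v. f v \<le> g v)"
  using checkable_nonneg[OF int_poly_diff[OF assms(2,1)]] by simp

lemma checkable_eq:
  assumes "int_poly K f" "int_poly K g" shows "checkable K (\<lambda>x v. f v = g v)"
  using checkable_conj[OF checkable_le[OF assms] checkable_le[OF assms(2,1)]]
  by (simp add: eq_iff)

lemma checkable_less:
  assumes "int_poly K f" "int_poly K g" shows "checkable K (\<lambda>x v. f v < g v)"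
  using checkable_le[OF int_poly_add[OF assms(1) int_poly_const[of _ 1]] assms(2)]
  by (simp add: add1_zle_eq)

text \<open>
  \<open>a\<^sup>2 (d\<^sup>2 - 1) \<ge> 0\<close> says over the integers that \<open>d = 0\<close> implies \<open>a = 0\<close>. With \<open>d = n - e\<close>
  the universally quantified loop counter \<open>n\<close> is thus made to visit the single time \<open>e\<close>.
\<close>

lemma guard_at_time:
  fixes a :: rat
  shows "0 \<le> a * a * ((of_nat n - of_int e) * (of_nat n - of_int e) - 1) \<longleftrightarrow> (int n = e \<longrightarrow> a = 0)"
proof (cases "int n = e")
  case True
  then have "rat_of_nat n - of_int e = 0" by (metis diff_self of_int_of_nat_eq)
  then show ?thesis using True by (auto simp: not_le) (metis antisym mult_eq_0_iff zero_le_square)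
next
  case False
  then have "(int n - e) * (int n - e) > 0" using zero_le_square[of "int n - e"] by (auto simp: less_le)
  then have "rat_of_int ((int n - e) * (int n - e)) \<ge> rat_of_int 1" by (subst of_int_le_iff) linarith
  then show ?thesis using False by (simp add: mult_nonneg_nonneg)
qed

text \<open>If \<open>f v\<close> is negative, no time equals it and the guard visiting that time is
  vacuous; therefore \<open>f v \<ge> 0\<close> is a guard of its own.\<close>

lemma checkable_power2:
  assumes "int_poly K f" "int_poly K g"
  shows "checkable K (\<lambda>x v. 0 \<le> f v \<and> g v = 2 ^ nat (f v))"
proof -
  obtain p where p: "p \<in> mpolys_in (5 + K)" "\<And>x n v. poly_at p (state x n v) = of_int (f v)"
    using assms(1) unfolding int_poly_def by blast
  obtain q where q: "q \<in> mpolys_in (5 + K)" "\<And>x n v. poly_at q (state x n v) = of_int (g v)"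
    using assms(2) unfolding int_poly_def by blast
  let ?r = "(q - var 3) * (q - var 3) * ((var 2 - p) * (var 2 - p) - const 1)"
  have r: "poly_at ?r (state x n v) \<ge> 0 \<longleftrightarrow> (int n = f v \<longrightarrow> g v = 2 ^ n)" for x n v
  proof -
    have "rat_of_int (g v) - 2 ^ n = 0 \<longleftrightarrow> rat_of_int (g v) = rat_of_int (2 ^ n)"
      by simp
    then show ?thesis
      by (simp only: of_int_eq_iff poly_at_simps state_simps p q poly_at_var poly_at_const of_int_1 guard_at_time)
  qed
  show ?thesis
    unfolding checkable_def
  proof (rule exI[of _ "[p, ?r]"], intro conjI allI)
    fix x v
    show "(0 \<le> f v \<and> g v = 2 ^ nat (f v)) \<longleftrightarrow> (\<forall>n. \<forall>p\<in>set [p, ?r]. 0 \<le> poly_at p (state x n v))"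
      using p(2) r by (auto simp del: of_int_power)
  qed (use p q in auto)
qed

text \<open>Coordinate 0 runs through the powers of \<open>x\<close>; visiting time 1 reads off
  \<open>x\<close> itself.\<close>

lemma checkable_input:
  assumes "int_poly K f"
  shows "checkable K (\<lambda>x v. f v = int x)"
proof -
  obtain p where p: "p \<in> mpolys_in (5 + K)" "\<And>x n v. poly_at p (state x n v) = of_int (f v)"
    using assms(1) unfolding int_poly_def by blast
  let ?r = "(p - var 0) * (p - var 0) * ((var 2 - const 1) * (var 2 - const 1) - const 1)"
  have r: "poly_at ?r (state x n v) \<ge> 0 \<longleftrightarrow> (int n = 1 \<longrightarrow> f v = int x ^ n)" for x n v
  proof -
    have "rat_of_int (f v) - of_nat x ^ n = 0 \<longleftrightarrow> rat_of_int (f v) = rat_of_int (int x ^ n)"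
      by simp
    moreover have "poly_at ?r (state x n v) =
        (of_int (f v) - of_nat x ^ n) * (of_int (f v) - of_nat x ^ n) *
        ((of_nat n - of_int 1) * (of_nat n - of_int 1) - 1)"
      by (simp add: poly_at_simps state_simps p)
    ultimately show ?thesis
      by (simp only: of_int_eq_iff guard_at_time)
  qed
  show ?thesis
    unfolding checkable_def
  proof (rule exI[of _ "[?r]"], intro conjI allI)
    fix x v
    show "f v = int x \<longleftrightarrow> (\<forall>n. \<forall>p\<in>set [?r]. 0 \<le> poly_at p (state x n v))"
      using r by auto
  qed (use p in auto)
qed

text \<open>
  The offset \<open>J\<close> is universally quantified so that the witnesses of a conjunction can be allocated
  one after the other.
\<close>

definition expressible :: "nat \<Rightarrow> (nat \<Rightarrow> (nat \<Rightarrow> int) \<Rightarrow> bool) \<Rightarrow> bool" where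
  "expressible K P \<longleftrightarrow> (\<forall>J \<ge> K. \<exists>M \<ge> J. \<exists>Q. checkable M Q \<and>
     (\<forall>x v. P x v \<longleftrightarrow> (\<exists>w. (\<forall>i<J. w i = v i) \<and> Q x w)))"

lemma expressible_checkable:
  assumes "checkable K P" shows "expressible K P"
  unfolding expressible_def
proof (intro allI impI)
  fix J assume "K \<le> J"
  then have J: "checkable J P" using assms checkable_mono by blast
  then have "P x v \<longleftrightarrow> (\<exists>w. (\<forall>i<J. w i = v i) \<and> P x w)" for x v
    using checkable_local[OF J] by blast
  with J show "\<exists>M \<ge> J. \<exists>Q. checkable M Q \<and> (\<forall>x v. P x v \<longleftrightarrow> (\<exists>w. (\<forall>i<J. w i = v i) \<and> Q x w))"
    by blast
qed

lemma expressible_local: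
  assumes "expressible K P" "\<And>i. i < K \<Longrightarrow> v i = w i"
  shows "P x v \<longleftrightarrow> P x w"
proof -
  obtain Q where "\<And>x v. P x v \<longleftrightarrow> (\<exists>w. (\<forall>i<K. w i = v i) \<and> Q x w)"
    using assms(1) unfolding expressible_def by blast
  with assms(2) show ?thesis by simp
qed

lemma expressible_conj:
  assumes P: "expressible K P" and Q: "expressible K Q"
  shows "expressible K (\<lambda>x v. P x v \<and> Q x v)"
  unfolding expressible_def
proof (intro allI impI)
  fix J assume J: "K \<le> J"
  obtain M P' where M: "J \<le> M" and P': "checkable M P'"
    and PP: "\<And>x v. P x v \<longleftrightarrow> (\<exists>w. (\<forall>i<J. w i = v i) \<and> P' x w)"
    using P J unfolding expressible_def by blast
  \<comment> \<open>The offset \<open>M\<close> instead of \<open>J\<close> places the witnesses of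
    \<open>Q\<close> above those of \<open>P\<close>, which they leave unchanged.\<close>
  obtain N Q' where N: "M \<le> N" and Q': "checkable N Q'"
    and QQ: "\<And>x v. Q x v \<longleftrightarrow> (\<exists>w. (\<forall>i<M. w i = v i) \<and> Q' x w)"
    using Q le_trans[OF J M] unfolding expressible_def by blast
  have eq: "(P x v \<and> Q x v) \<longleftrightarrow> (\<exists>w. (\<forall>i<J. w i = v i) \<and> P' x w \<and> Q' x w)" for x v
  proof
    assume "P x v \<and> Q x v"
    then obtain w where w: "\<forall>i<J. w i = v i" "P' x w" using PP by blast
    have "Q x w" using expressible_local[OF Q, of w v] w(1) J \<open>P x v \<and> Q x v\<close> by auto
    then obtain u where u: "\<forall>i<M. u i = w i" "Q' x u" using QQ by blast
    have "P' x u" using checkable_local[OF P', of u w] u(1) w(2) by auto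
    with u w M show "\<exists>w. (\<forall>i<J. w i = v i) \<and> P' x w \<and> Q' x w" by (intro exI[of _ u]) auto
  next
    assume "\<exists>w. (\<forall>i<J. w i = v i) \<and> P' x w \<and> Q' x w"
    then obtain w where w: "\<forall>i<J. w i = v i" "P' x w" "Q' x w" by blast
    then have "P x v" "Q x w" using PP QQ by blast+
    with expressible_local[OF Q, of w v] w(1) J show "P x v \<and> Q x v" by auto
  qed
  show "\<exists>M \<ge> J. \<exists>R. checkable M R \<and>
      (\<forall>x v. (P x v \<and> Q x v) \<longleftrightarrow> (\<exists>w. (\<forall>i<J. w i = v i) \<and> R x w))"
    by (rule exI[of _ N], rule conjI[OF le_trans[OF M N]],
        rule exI[of _ "\<lambda>x v. P' x v \<and> Q' x v"],
        rule conjI[OF checkable_conj[OF checkable_mono[OF P' N] Q']], intro allI, rule eq)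
qed

lemma expressible_all_less:
  fixes n :: nat
  assumes "\<And>i. i < n \<Longrightarrow> expressible K (P i)"
  shows "expressible K (\<lambda>x v. \<forall>i<n. P i x v)"
  using assms
proof (induction n)
  case 0
  then show ?case using expressible_checkable[OF checkable_True] by simp
next
  case (Suc n)
  then have "expressible K (\<lambda>x v. (\<forall>i<n. P i x v) \<and> P n x v)"
    by (intro expressible_conj) auto
  then show ?case by (simp add: less_Suc_eq all_conj_distrib)
qed

section \<open>Parity of binomial coefficients as an exponential Diophantine condition\<close>

text \<open>
  A binomial coefficient is a digit of \<open>(1 + w)\<^sup>s\<close> in base \<open>w = 2\<^sup>s\<^sup>+\<^sup>1\<close>, and \<open>(1 + w)\<^sup>s\<close> is the
  remainder of \<open>(2\<^sup>e)\<^sup>s\<close> modulo \<open>2\<^sup>e - (1 + w)\<close> for large \<open>e\<close>.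
\<close>

definition odd_binomial :: "int \<Rightarrow> int \<Rightarrow> bool" where
  "odd_binomial r s \<longleftrightarrow> 0 \<le> r \<and> 0 \<le> s \<and> odd (nat s choose nat r)"

text \<open>Each coefficient of the binomial expansion is below \<open>w\<close>, so the terms
  before index \<open>r\<close> sum to less than \<open>w ^ r\<close>, and those after it are
  multiples of \<open>w * w ^ r\<close>.\<close>

lemma choose_digit:
  fixes s r :: nat
  defines "w \<equiv> (2::int) ^ (s + 1)"
  obtains q l where "(1 + w) ^ s = q * (w * w ^ r) + int (s choose r) * w ^ r + l"
    "0 \<le> l" "l < w ^ r"
proof -
  have w0: "w \<ge> 2" by (simp add: w_def)
  have exp: "(1 + w) ^ s = (\<Sum>i\<le>s. int (s choose i) * w ^ i)"
    by (subst add.commute) (simp add: binomial_ring)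
  have low: "(\<Sum>i<m. int (s choose i) * w ^ i) < w ^ m" for m
  proof (induction m)
    case (Suc m)
    have "(s choose m) < 2 ^ (s + 1)"
      using binomial_le_pow2[of s m] by (simp add: le_less_trans)
    then have "int (s choose m) + 1 \<le> w" unfolding w_def by (metis Suc_leI of_nat_Suc of_nat_le_iff of_nat_numeral of_nat_power add.commute)
    then have "(int (s choose m) + 1) * w ^ m \<le> w * w ^ m" using w0 by (intro mult_right_mono) auto
    with Suc show ?case by (simp add: algebra_simps)
  qed simp
  let ?f = "\<lambda>i. int (s choose i) * w ^ i"
  let ?q = "\<Sum>i\<in>{r + 1..<s + r + 2}. int (s choose i) * w ^ (i - (r + 1))"
  \<comment> \<open>The range is extended past \<open>s\<close>, where the coefficients vanish, to
    contain the index \<open>r\<close> even if \<open>r > s\<close>.\<close>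
  have "(1 + w) ^ s = (\<Sum>i<s + r + 2. ?f i)"
    unfolding exp by (rule sum.mono_neutral_left) auto
  also have "\<dots> = (\<Sum>i<r. ?f i) + ?f r + (\<Sum>i\<in>{r + 1..<s + r + 2}. ?f i)"
  proof -
    have "sum ?f {..<s + r + 2} = sum ?f {..<r + 1} + sum ?f {r + 1..<s + r + 2}"
      unfolding lessThan_atLeast0 by (rule sum.atLeastLessThan_concat[symmetric]) auto
    moreover have "sum ?f {..<r + 1} = sum ?f {..<r} + ?f r" by simp
    ultimately show ?thesis by (simp only:)
  qed
  also have "(\<Sum>i\<in>{r + 1..<s + r + 2}. ?f i) = ?q * (w * w ^ r)"
    unfolding sum_distrib_right
    by (intro sum.cong) (auto simp: mult_ac simp flip: power_add power_Suc)
  finally have "(1 + w) ^ s = ?q * (w * w ^ r) + ?f r + (\<Sum>i<r. ?f i)" by simp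
  then show thesis
    using w0 low[of r] by (intro that[of ?q "\<Sum>i<r. ?f i"]) (auto intro!: sum_nonneg)
qed

lemma digits_unique:
  fixes w W :: int
  assumes "q * (w * W) + d * W + l = q' * (w * W) + d' * W + l'"
    "0 \<le> l" "l < W" "0 \<le> l'" "l' < W" "0 \<le> d" "d < w" "0 \<le> d'" "d' < w"
  shows "d = d'"
proof -
  have "(q * (w * W) + d * W + l) div W mod w = d" if "0 \<le> l" "l < W" "0 \<le> d" "d < w" for q d l
  proof -
    have "q * (w * W) + d * W + l = (q * w + d) * W + l" by (simp add: algebra_simps)
    then have "(q * (w * W) + d * W + l) div W = q * w + d"
      using that by simp
    then show ?thesis using that by simp
  qed
  then show ?thesis using assms by metis
qed

text \<open>Modulo \<open>V - (1 + w)\<close> the numbers \<open>V\<close> and \<open>1 + w\<close>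
  agree, hence so do \<open>V' = V ^ s\<close> and \<open>(1 + w) ^ s\<close>. As \<open>V\<close>
  is large, the latter is the remainder \<open>T\<close>, and its digit in front of
  \<open>W = w ^ r\<close> is the coefficient, required to be odd as \<open>2 * d + 1\<close>. The
  only exponentials left are powers of two with polynomial exponents.\<close>

lemma odd_binomial_iff:
  assumes s: "0 \<le> s" and r: "0 \<le> r"
  shows "odd_binomial r s \<longleftrightarrow> (\<exists>(w::int) W V V' g T q d l.
     w = 2 ^ nat (s + 1) \<and> W = 2 ^ nat ((s + 1) * r) \<and>
     V = 2 ^ nat ((s + 2) * (s + 1) + 1) \<and> V' = 2 ^ nat (((s + 2) * (s + 1) + 1) * s) \<and>
     V' = g * (V - (1 + w)) + T \<and> 0 \<le> T \<and> T < V - (1 + w) \<and>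
     T = q * (w * W) + (2 * d + 1) * W + l \<and> 0 \<le> l \<and> l < W \<and> 0 \<le> d \<and> 2 * d + 1 < w)"
    (is "_ \<longleftrightarrow> (\<exists>w W V V' g T q d l. ?R w W V V' g T q d l)")
proof -
  define m k where "m = nat s" and "k = nat r"
  have sm: "s = int m" and rk: "r = int k" using assms by (simp_all add: m_def k_def)
  define w where "w = (2::int) ^ nat (s + 1)"
  define W where "W = (2::int) ^ nat ((s + 1) * r)"
  define V where "V = (2::int) ^ nat ((s + 2) * (s + 1) + 1)"
  define V' where "V' = (2::int) ^ nat (((s + 2) * (s + 1) + 1) * s)"
  have w: "w = 2 ^ (m + 1)"
    unfolding w_def sm by (simp add: nat_add_distrib)
  have W: "W = w ^ k"
  proof -
    have "(s + 1) * r = int ((m + 1) * k)" by (simp add: sm rk algebra_simps)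
    then show ?thesis unfolding W_def w by (simp only: nat_int power_mult)
  qed
  have V: "V = 2 ^ ((m + 2) * (m + 1) + 1)"
  proof -
    have "(s + 2) * (s + 1) + 1 = int ((m + 2) * (m + 1) + 1)" by (simp add: sm algebra_simps)
    then show ?thesis unfolding V_def by (simp only: nat_int)
  qed
  have V': "V' = V ^ m"
  proof -
    have "((s + 2) * (s + 1) + 1) * s = int (((m + 2) * (m + 1) + 1) * m)" by (simp add: sm algebra_simps)
    then show ?thesis unfolding V'_def V by (simp only: nat_int power_mult)
  qed
  define T where "T = (1 + w) ^ m"
  have "w \<ge> 2" "2 ^ (m + 2) = 2 * w" by (simp_all add: w)
  then have lt: "1 + w < 2 ^ (m + 2)" by linarith
  then have "T \<le> (2 ^ (m + 2)) ^ m" unfolding T_def by (intro power_mono) (auto simp: w)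
  also have "\<dots> \<le> 2 ^ ((m + 2) * (m + 1))" by (subst power_mult[symmetric]) (rule power_increasing, auto)
  finally have "T \<le> 2 ^ ((m + 2) * (m + 1))" .
  moreover have "(2::int) ^ (m + 2) \<le> 2 ^ ((m + 2) * (m + 1))" by (rule power_increasing) auto
  \<comment> \<open>Neither \<open>T\<close> nor \<open>1 + w\<close> exceeds half of
    \<open>V\<close>, and the second is strictly smaller, so \<open>T\<close> is a reduced
    remainder.\<close>
  moreover have "V = 2 ^ ((m + 2) * (m + 1)) * 2"
    unfolding V by (simp only: power_add power_one_right)
  ultimately have TV: "T < V - (1 + w)" using lt by linarith
  have T0: "0 \<le> T" by (simp add: T_def w)
  have "(V - (1 + w)) dvd (V ^ m - (1 + w) ^ m)"
    by (metis dvd_triv_left power_diff_sumr2)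
  then obtain g where "V ^ m - (1 + w) ^ m = (V - (1 + w)) * g" by (rule dvdE)
  then have g: "V' = g * (V - (1 + w)) + T" by (simp add: V' T_def algebra_simps)
  obtain q l where ql: "T = q * (w * W) + int (m choose k) * W + l" "0 \<le> l" "l < W"
    using choose_digit[of m k] unfolding T_def W w by metis
  have cw: "int (m choose k) < w"
  proof -
    have "(m choose k) < 2 ^ (m + 1)" using binomial_le_pow2[of m k] by (simp add: le_less_trans)
    then show ?thesis unfolding w by (metis of_nat_less_iff of_nat_numeral of_nat_power)
  qed
  show ?thesis
  proof
    assume "odd_binomial r s"
    then obtain d where d: "m choose k = 2 * d + 1" by (auto simp: odd_binomial_def m_def k_def elim: oddE)
    have "?R w W V V' g T q (int d) l"
      using g ql TV T0 cw d by (simp add: w_def W_def V_def V'_def)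
    then show "\<exists>w W V V' g T q d l. ?R w W V V' g T q d l" by blast
  next
    assume "\<exists>w W V V' g T q d l. ?R w W V V' g T q d l"
    then obtain g' T' q' d' l' where R: "?R w W V V' g' T' q' d' l'"
      unfolding w_def W_def V_def V'_def by blast
    have rem: "V' mod (V - (1 + w)) = t" if "V' = h * (V - (1 + w)) + t" "0 \<le> t" "t < V - (1 + w)" for h t
      unfolding that(1) using that(2,3) by simp
    have "T' = V' mod (V - (1 + w))" using R rem by metis
    also have "\<dots> = T" using g T0 TV by (rule rem)
    finally have "T' = T" .
    moreover have "T' = q' * (w * W) + (2 * d' + 1) * W + l'" using R by blast
    ultimately have "q' * (w * W) + (2 * d' + 1) * W + l' = q * (w * W) + int (m choose k) * W + l"
      using ql(1) by metis
    then have "2 * d' + 1 = int (m choose k)"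
      by (rule digits_unique) (use R ql cw in auto)
    then have "odd (int (m choose k))" by (metis odd_two_times_div_two_succ dvd_triv_left even_add odd_one)
    then show "odd_binomial r s" using assms by (simp add: odd_binomial_def m_def k_def)
  qed
qed

lemma expressible_odd_binomial:
  assumes f: "int_poly K f" and g: "int_poly K g"
  shows "expressible K (\<lambda>x v. odd_binomial (f v) (g v))"
  unfolding expressible_def
proof (intro allI impI)
  fix J assume J: "K \<le> J"
  have fg: "int_poly (J + 9) f" "int_poly (J + 9) g"
    using f g J by (auto elim!: int_poly_mono)
  \<comment> \<open>The coordinates \<open>J\<close> to \<open>J + 8\<close> hold the nine witnesses
    \<open>w\<close>, \<open>W\<close>, \<open>V\<close>, \<open>V'\<close>, \<open>g\<close>,
    \<open>T\<close>, \<open>q\<close>, \<open>d\<close>, \<open>l\<close> of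
    \<open>odd_binomial_iff\<close>, in this order.\<close>
  define Q where "Q = (\<lambda>(x::nat) v.
     0 \<le> g v \<and> 0 \<le> f v \<and>
     (0 \<le> g v + 1 \<and> v J = 2 ^ nat (g v + 1)) \<and>
     (0 \<le> (g v + 1) * f v \<and> v (J + 1) = 2 ^ nat ((g v + 1) * f v)) \<and>
     (0 \<le> (g v + 2) * (g v + 1) + 1 \<and> v (J + 2) = 2 ^ nat ((g v + 2) * (g v + 1) + 1)) \<and>
     (0 \<le> ((g v + 2) * (g v + 1) + 1) * g v \<and>
       v (J + 3) = 2 ^ nat (((g v + 2) * (g v + 1) + 1) * g v)) \<and>
     v (J + 3) = v (J + 4) * (v (J + 2) - (1 + v J)) + v (J + 5) \<and> 0 \<le> v (J + 5) \<and>
     v (J + 5) < v (J + 2) - (1 + v J) \<and>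
     v (J + 5) = v (J + 6) * (v J * v (J + 1)) + (2 * v (J + 7) + 1) * v (J + 1) + v (J + 8) \<and>
     0 \<le> v (J + 8) \<and> v (J + 8) < v (J + 1) \<and> 0 \<le> v (J + 7) \<and> 2 * v (J + 7) + 1 < v J)"
  have chk: "checkable (J + 9) Q"
    unfolding Q_def
    by (intro checkable_conj checkable_power2 checkable_eq checkable_le checkable_less
        int_poly_intros fg) auto
  have eq: "odd_binomial (f v) (g v) \<longleftrightarrow> (\<exists>w. (\<forall>i<J. w i = v i) \<and> Q x w)" for x v
  proof
    assume *: "odd_binomial (f v) (g v)"
    then have nn: "0 \<le> f v" "0 \<le> g v" by (auto simp: odd_binomial_def)
    then have nn': "0 \<le> g v + 1" "0 \<le> (g v + 1) * f v" "0 \<le> (g v + 2) * (g v + 1) + 1"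
      "0 \<le> ((g v + 2) * (g v + 1) + 1) * g v" by simp_all
    obtain w0 w1 w2 w3 w4 w5 w6 w7 w8 :: int where R:
     "w0 = 2 ^ nat (g v + 1) \<and> w1 = 2 ^ nat ((g v + 1) * f v) \<and>
     w2 = 2 ^ nat ((g v + 2) * (g v + 1) + 1) \<and> w3 = 2 ^ nat (((g v + 2) * (g v + 1) + 1) * g v) \<and>
     w3 = w4 * (w2 - (1 + w0)) + w5 \<and> 0 \<le> w5 \<and> w5 < w2 - (1 + w0) \<and>
     w5 = w6 * (w0 * w1) + (2 * w7 + 1) * w1 + w8 \<and> 0 \<le> w8 \<and> w8 < w1 \<and> 0 \<le> w7 \<and> 2 * w7 + 1 < w0"
      using iffD1[OF odd_binomial_iff[OF nn(2) nn(1)] *] by (elim exE) (rule that)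
    define u where "u = (\<lambda>i. if i < J then v i else [w0, w1, w2, w3, w4, w5, w6, w7, w8] ! (i - J))"
    have u: "u J = w0" "u (J + 1) = w1" "u (J + 2) = w2" "u (J + 3) = w3" "u (J + 4) = w4"
      "u (J + 5) = w5" "u (J + 6) = w6" "u (J + 7) = w7" "u (J + 8) = w8"
      by (simp_all add: u_def)
    have fg_u: "f u = f v" "g u = g v"
      using J by (auto intro!: int_poly_local[OF f] int_poly_local[OF g] simp: u_def)
    then have "Q x u"
      unfolding Q_def u fg_u using R nn nn' by blast
    then show "\<exists>w. (\<forall>i<J. w i = v i) \<and> Q x w"
      by (intro exI[of _ u]) (simp add: u_def)
  next
    assume "\<exists>w. (\<forall>i<J. w i = v i) \<and> Q x w"
    then obtain w where w: "\<forall>i<J. w i = v i" "Q x w" by blast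
    have "f w = f v" "g w = g v"
      using J w(1) by (auto intro!: int_poly_local[OF f] int_poly_local[OF g])
    moreover have "odd_binomial (f w) (g w)"
    proof -
      have nn: "0 \<le> g w" "0 \<le> f w" using w(2) by (simp_all add: Q_def)
      show ?thesis
        unfolding odd_binomial_iff[OF nn]
        by (rule exI[of _ "w J"], rule exI[of _ "w (J + 1)"], rule exI[of _ "w (J + 2)"],
            rule exI[of _ "w (J + 3)"], rule exI[of _ "w (J + 4)"], rule exI[of _ "w (J + 5)"],
            rule exI[of _ "w (J + 6)"], rule exI[of _ "w (J + 7)"], rule exI[of _ "w (J + 8)"])
          (use w(2) in \<open>unfold Q_def, blast\<close>)
    qed
    ultimately show "odd_binomial (f v) (g v)" by simp
  qed
  show "\<exists>M \<ge> J. \<exists>Q. checkable M Q \<and>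
      (\<forall>x v. odd_binomial (f v) (g v) \<longleftrightarrow> (\<exists>w. (\<forall>i<J. w i = v i) \<and> Q x w))"
    by (rule exI[of _ "J + 9"], rule conjI, simp, rule exI[of _ Q], rule conjI[OF chk],
        intro allI, rule eq)
qed

section \<open>Programming register machines\<close>

text \<open>As with \<open>Dec\<close>, a test that finds a nonzero register decrements it before
  the body is entered; this is the only way to decrement.\<close>

datatype com = INC nat | SEQ com com (infixr ";;" 60) | WHILE nat com | IF nat com com

inductive exec :: "com \<Rightarrow> (nat \<Rightarrow> nat) \<Rightarrow> (nat \<Rightarrow> nat) \<Rightarrow> bool" where
  INC: "exec (INC r) s (s(r := Suc (s r)))"
| SEQ: "exec c s t \<Longrightarrow> exec d t u \<Longrightarrow> exec (c ;; d) s u"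
| WHILE_0: "s r = 0 \<Longrightarrow> exec (WHILE r c) s s"
| WHILE_Suc: "s r = Suc n \<Longrightarrow> exec c (s(r := n)) t \<Longrightarrow> exec (WHILE r c) t u \<Longrightarrow> exec (WHILE r c) s u"
| IF_0: "s r = 0 \<Longrightarrow> exec d s t \<Longrightarrow> exec (IF r c d) s t"
| IF_Suc: "s r = Suc n \<Longrightarrow> exec c (s(r := n)) t \<Longrightarrow> exec (IF r c d) s t"

fun code_size :: "com \<Rightarrow> nat" where
  "code_size (INC r) = 1"
| "code_size (c ;; d) = code_size c + code_size d"
| "code_size (WHILE r c) = Suc (code_size c)"
| "code_size (IF r c d) = Suc (code_size c + code_size d)"

text \<open>The code of \<open>c\<close> occupies the addresses from \<open>a\<close> on and leaves to address \<open>k\<close>.\<close>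

fun compile :: "com \<Rightarrow> nat \<Rightarrow> nat \<Rightarrow> instr list" where
  "compile (INC r) a k = [Inc r k]"
| "compile (c ;; d) a k = compile c a (a + code_size c) @ compile d (a + code_size c) k"
| "compile (WHILE r c) a k = Dec r (Suc a) k # compile c (Suc a) a"
| "compile (IF r c d) a k =
     Dec r (Suc a) (Suc a + code_size c) # compile c (Suc a) k @ compile d (Suc a + code_size c) k"

lemma length_compile [simp]: "length (compile c a k) = code_size c"
  by (induction c arbitrary: a k) simp_all

section \<open>Runs of machines and correctness of compiled code\<close>

definition reaches :: "instr list \<Rightarrow> config \<Rightarrow> config \<Rightarrow> bool" where
  "reaches prog x y \<longleftrightarrow> (\<exists>t. (rm_step prog ^^ t) x = y)"

lemma reaches_refl: "reaches prog x x"
  unfolding reaches_def by (rule exI[of _ 0]) simp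

lemma reaches_trans: "reaches prog x y \<Longrightarrow> reaches prog y z \<Longrightarrow> reaches prog x z"
  unfolding reaches_def by (metis comp_apply funpow_add)

lemma reaches_step: "rm_step prog x = y \<Longrightarrow> reaches prog x y"
  unfolding reaches_def by (rule exI[of _ 1]) simp

definition placed :: "instr list \<Rightarrow> nat \<Rightarrow> instr list \<Rightarrow> bool" where
  "placed prog a code \<longleftrightarrow> (\<forall>i < length code. a + i < length prog \<and> prog ! (a + i) = code ! i)"

lemma placed_Cons:
  "placed prog a (i # code) \<longleftrightarrow> a < length prog \<and> prog ! a = i \<and> placed prog (Suc a) code"
  unfolding placed_def by (auto simp: less_Suc_eq_0_disj)

lemma placed_append:
  "placed prog a (code @ code') \<longleftrightarrow> placed prog a code \<and> placed prog (a + length code) code'"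
  by (induction code arbitrary: a) (auto simp: placed_Cons, auto simp: placed_def)

lemma placed_middle: "placed (xs @ code @ ys) (length xs) code"
  by (auto simp: placed_def nth_append)

lemma compile_correct:
  assumes "exec c s t" "placed prog a (compile c a k)"
  shows "reaches prog (a, s) (k, t)"
  using assms
proof (induction arbitrary: a k)
  case (INC r s)
  then show ?case by (intro reaches_step) (auto simp: placed_Cons)
next
  case (SEQ c s t d u)
  then have "reaches prog (a, s) (a + code_size c, t)" "reaches prog (a + code_size c, t) (k, u)"
    by (auto simp: placed_append)
  then show ?case by (rule reaches_trans)
next
  case (WHILE_0 s r c)
  then show ?case by (intro reaches_step) (auto simp: placed_Cons)
next
  case (WHILE_Suc s r n c t u)
  then have "reaches prog (a, s) (Suc a, s(r := n))"
    by (intro reaches_step) (auto simp: placed_Cons)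
  moreover have "reaches prog (Suc a, s(r := n)) (a, t)"
    by (rule WHILE_Suc.IH(1)) (use WHILE_Suc.prems in \<open>simp add: placed_Cons\<close>)
  moreover have "reaches prog (a, t) (k, u)"
    by (rule WHILE_Suc.IH(2)) (use WHILE_Suc.prems in simp)
  ultimately show ?case by (meson reaches_trans)
next
  case (IF_0 s r d t c)
  then have "reaches prog (a, s) (Suc a + code_size c, s)"
    by (intro reaches_step) (auto simp: placed_Cons)
  moreover have "reaches prog (Suc a + code_size c, s) (k, t)"
    by (rule IF_0.IH) (use IF_0.prems in \<open>simp add: placed_Cons placed_append\<close>)
  ultimately show ?case by (rule reaches_trans)
next
  case (IF_Suc s r n c t d)
  then have "reaches prog (a, s) (Suc a, s(r := n))"
    by (intro reaches_step) (auto simp: placed_Cons)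
  moreover have "reaches prog (Suc a, s(r := n)) (k, t)"
    by (rule IF_Suc.IH) (use IF_Suc.prems in \<open>simp add: placed_Cons placed_append\<close>)
  ultimately show ?case by (rule reaches_trans)
qed

text \<open>\<open>f i\<close> is the state after \<open>i\<close> rounds. The tested register
  counts the remaining rounds, so the claim follows by induction from \<open>n\<close>
  downwards.\<close>

lemma exec_WHILE:
  assumes "\<And>i. i \<le> n \<Longrightarrow> f i r = n - i"
    and "\<And>i. i < n \<Longrightarrow> exec c ((f i)(r := n - Suc i)) (f (Suc i))"
  shows "exec (WHILE r c) (f 0) (f n)"
proof -
  have "exec (WHILE r c) (f i) (f n)" if "i \<le> n" for i
    using that
  proof (induction rule: inc_induct)
    case base
    then show ?case using assms(1)[of n] by (intro WHILE_0) simp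
  next
    case (step i)
    show ?case
    proof (rule exec.WHILE_Suc[where n = "n - Suc i"])
      show "f i r = Suc (n - Suc i)" using assms(1)[of i] step.hyps by simp
      show "exec c ((f i)(r := n - Suc i)) (f (Suc i))" using step.hyps by (intro assms(2)) simp
    qed (rule step.IH)
  qed
  then show ?thesis by blast
qed

section \<open>Copying, doubling, pairing and unpairing of registers\<close>

lemma exec_eq: "exec c s t \<Longrightarrow> t = u \<Longrightarrow> exec c s u"
  by simp

lemma exec_move:
  assumes "r \<noteq> q"
  shows "exec (WHILE r (INC q)) s (s(r := 0, q := s q + s r))"
proof -
  let ?f = "\<lambda>i. s(r := s r - i, q := s q + i)"
  have "exec (WHILE r (INC q)) (?f 0) (?f (s r))"
  proof (rule exec_WHILE)
    fix i
    show "exec (INC q) ((?f i)(r := s r - Suc i)) (?f (Suc i))"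
      by (rule exec_eq[OF exec.INC]) (use assms in \<open>auto simp: fun_eq_iff\<close>)
  qed (use assms in auto)
  then show ?thesis by simp
qed

lemma exec_move2:
  assumes "r \<noteq> p" "r \<noteq> q" "p \<noteq> q"
  shows "exec (WHILE r (INC p ;; INC q)) s (s(r := 0, p := s p + s r, q := s q + s r))"
proof -
  let ?f = "\<lambda>i. s(r := s r - i, p := s p + i, q := s q + i)"
  have "exec (WHILE r (INC p ;; INC q)) (?f 0) (?f (s r))"
  proof (rule exec_WHILE)
    fix i
    show "exec (INC p ;; INC q) ((?f i)(r := s r - Suc i)) (?f (Suc i))"
      by (rule exec.SEQ[OF exec.INC exec_eq[OF exec.INC]]) (use assms in \<open>auto simp: fun_eq_iff\<close>)
  qed (use assms in auto)
  then show ?thesis by simp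
qed

lemma exec_double:
  assumes "r \<noteq> p" "r \<noteq> q" "p \<noteq> q"
  shows "exec (WHILE r (INC p ;; INC q ;; INC q)) s (s(r := 0, p := s p + s r, q := s q + 2 * s r))"
proof -
  let ?f = "\<lambda>i. s(r := s r - i, p := s p + i, q := s q + 2 * i)"
  have "exec (WHILE r (INC p ;; INC q ;; INC q)) (?f 0) (?f (s r))"
  proof (rule exec_WHILE)
    fix i
    show "exec (INC p ;; INC q ;; INC q) ((?f i)(r := s r - Suc i)) (?f (Suc i))"
      by (rule exec.SEQ[OF exec.INC exec.SEQ[OF exec.INC exec_eq[OF exec.INC]]])
        (use assms in \<open>auto simp: fun_eq_iff\<close>)
  qed (use assms in auto)
  then show ?thesis by simp
qed

text \<open>\<open>prod_encode (m, n)\<close> is \<open>triangle (m + n) + m\<close>. The first loop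
  adds \<open>a\<close> to both \<open>b\<close> and \<open>c\<close>, the second adds the
  triangular number of \<open>b\<close> to \<open>c\<close>; \<open>d\<close> is scratch
  space.\<close>

definition PAIR :: "nat \<Rightarrow> nat \<Rightarrow> nat \<Rightarrow> nat \<Rightarrow> com" where
  "PAIR a b c d = WHILE a (INC c ;; INC b) ;;
     WHILE b (INC c ;; WHILE b (INC c ;; INC d) ;; WHILE d (INC b))"

lemma exec_triangle:
  assumes "b \<noteq> c" "b \<noteq> d" "c \<noteq> d" "s d = 0"
  shows "exec (WHILE b (INC c ;; WHILE b (INC c ;; INC d) ;; WHILE d (INC b))) s
     (s(b := 0, c := s c + triangle (s b)))"
  using assms(4)
proof (induction "s b" arbitrary: s)
  case 0
  then show ?case by (intro exec_eq[OF exec.WHILE_0]) (auto simp: fun_eq_iff)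
next
  case (Suc n)
  let ?t = "s(b := n, c := s c + Suc n)"
  have body: "exec (INC c ;; WHILE b (INC c ;; INC d) ;; WHILE d (INC b)) (s(b := n)) ?t"
    by (rule exec.SEQ[OF exec.INC exec.SEQ[OF exec_move2 exec_eq[OF exec_move]]])
      (use assms(1-3) Suc.prems in \<open>auto simp: fun_eq_iff\<close>)
  have rest: "exec (WHILE b (INC c ;; WHILE b (INC c ;; INC d) ;; WHILE d (INC b))) ?t
      (?t(b := 0, c := ?t c + triangle (?t b)))"
    using assms(1-3) Suc.prems by (intro Suc.hyps(1)) auto
  show ?case
    by (rule exec_eq[OF exec.WHILE_Suc[OF Suc.hyps(2)[symmetric] body rest]]) (use assms(1-3) Suc.hyps(2)[symmetric] in \<open>auto simp: fun_eq_iff\<close>)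
qed

lemma exec_PAIR:
  assumes "distinct [a, b, c, d]" "s d = 0"
  shows "exec (PAIR a b c d) s (s(a := 0, b := 0, c := s c + prod_encode (s a, s b)))"
  unfolding PAIR_def
  by (rule exec.SEQ[OF exec_move2 exec_eq[OF exec_triangle]])
    (use assms in \<open>auto simp: fun_eq_iff prod_encode_def add_ac\<close>)

text \<open>Every unit taken from \<open>z\<close> moves \<open>(a, b)\<close> one step along the
  enumeration of pairs, as in \<open>prod_decode_Suc\<close>.\<close>

definition UNPAIR :: "nat \<Rightarrow> nat \<Rightarrow> nat \<Rightarrow> com" where
  "UNPAIR z a b = WHILE z (IF b (INC a) (INC b ;; WHILE a (INC b)))"

text \<open>The enumeration runs along the diagonals of constant sum, with the first component
  increasing; at the end of a diagonal it starts the next one.\<close>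

lemma prod_decode_Suc:
  "prod_decode (Suc n) =
     (case prod_decode n of (p, 0) \<Rightarrow> (0, Suc p) | (p, Suc q) \<Rightarrow> (Suc p, q))"
proof -
  obtain p q where pq: "prod_decode n = (p, q)" by fastforce
  then have n: "n = prod_encode (p, q)" by (metis prod_decode_inverse)
  have "prod_encode (case q of 0 \<Rightarrow> (0, Suc p) | Suc r \<Rightarrow> (Suc p, r)) = Suc n"
    by (cases q) (simp_all add: n prod_encode_def)
  then have "prod_decode (Suc n) = (case q of 0 \<Rightarrow> (0, Suc p) | Suc r \<Rightarrow> (Suc p, r))"
    by (metis prod_encode_inverse)
  then show ?thesis by (simp add: pq)
qed

lemma prod_decode_0: "prod_decode 0 = (0, 0)"
  using prod_encode_inverse[of "(0, 0)"] by (simp add: prod_encode_def)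

lemma exec_UNPAIR:
  assumes "distinct [z, a, b]" "s a = 0" "s b = 0"
  shows "exec (UNPAIR z a b) s
    (s(z := 0, a := fst (prod_decode (s z)), b := snd (prod_decode (s z))))"
proof -
  let ?f = "\<lambda>i. s(z := s z - i, a := fst (prod_decode i), b := snd (prod_decode i))"
  have "exec (WHILE z (IF b (INC a) (INC b ;; WHILE a (INC b)))) (?f 0) (?f (s z))"
  proof (rule exec_WHILE)
    fix i
    let ?g = "(?f i)(z := s z - Suc i)"
    obtain p q where pq: "prod_decode i = (p, q)" by fastforce
    show "exec (IF b (INC a) (INC b ;; WHILE a (INC b))) ?g (?f (Suc i))"
    proof (cases q)
      case 0
      show ?thesis
        by (rule exec.IF_0[OF _ exec.SEQ[OF exec.INC exec_eq[OF exec_move]]])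
          (use assms 0 pq in \<open>auto simp: fun_eq_iff prod_decode_Suc\<close>)
    next
      case (Suc r)
      show ?thesis
        by (rule exec.IF_Suc[where n = r, OF _ exec_eq[OF exec.INC]])
          (use assms Suc pq in \<open>auto simp: fun_eq_iff prod_decode_Suc\<close>)
    qed
  qed (use assms in auto)
  moreover have "?f 0 = s" using assms by (auto simp: fun_eq_iff prod_decode_0)
  ultimately show ?thesis by (simp add: UNPAIR_def)
qed

text \<open>The input packs the rest \<open>a\<close> of the first row, the remaining rows
  \<open>b\<close>, the guards \<open>c\<close> and the dimension \<open>d\<close>. The pair
  \<open>(2 * x, 2)\<close> codes the rational number \<open>x\<close>, and each
  \<open>Suc (prod_encode _)\<close> is a list constructor, so the result codes the loop with
  \<open>x\<close> as its first entry.\<close>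

definition fill :: "nat \<Rightarrow> nat" where
  "fill x = (case prod_decode x of (a, y) \<Rightarrow> case prod_decode y of (b, z) \<Rightarrow>
     case prod_decode z of (c, d) \<Rightarrow>
       prod_encode (d, prod_encode (Suc (prod_encode (Suc (prod_encode
         (prod_encode (2 * x, 2), a)), b)), c)))"

text \<open>Register 1 takes a copy of the input and is scratch space once unpacked; register 2
  holds \<open>2 * x\<close>, the registers 3, 5, 7, 8 the four parts, 9 the number 2, and 10 to 13
  the partial results. All registers but 0 end at 0, so that the next program finds the memory it
  expects.\<close>

definition FILL :: com where
  "FILL = WHILE 0 (INC 1 ;; INC 2 ;; INC 2) ;; UNPAIR 1 3 4 ;; UNPAIR 4 5 6 ;; UNPAIR 6 7 8 ;;
     INC 9 ;; INC 9 ;; PAIR 2 9 10 1 ;; PAIR 10 3 11 1 ;; INC 11 ;; PAIR 11 5 12 1 ;; INC 12 ;;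
     PAIR 12 7 13 1 ;; PAIR 8 13 0 1"

lemma exec_FILL: "exec FILL ((\<lambda>_. 0)(0 := x)) ((\<lambda>_. 0)(0 := fill x))"
proof -
  obtain a y where ay: "prod_decode x = (a, y)" by fastforce
  obtain b z where bz: "prod_decode y = (b, z)" by fastforce
  obtain c d where cd: "prod_decode z = (c, d)" by fastforce
  let ?p = "prod_encode (2 * x, 2)"
  let ?q = "prod_encode (?p, a)"
  let ?r = "prod_encode (Suc ?q, b)"
  \<comment> \<open>States are written as association lists; registers not listed are 0.\<close>
  let ?S = "\<lambda>(xs :: (nat \<times> nat) list) i. (case map_of xs i of None \<Rightarrow> 0 | Some v \<Rightarrow> v)"
  have S0: "(\<lambda>_. 0)(0 := v) = ?S [(0::nat, v)]" for v by (auto simp: fun_eq_iff)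
  have "exec FILL (?S [(0, x)]) (?S [(0, fill x)])"
    unfolding FILL_def
    apply (rule exec.SEQ, rule exec_eq[OF exec_double, where u = "?S [(1, x), (2, 2 * x)]"])
        apply (auto simp: fun_eq_iff)[4]
    apply (rule exec.SEQ, rule exec_eq[OF exec_UNPAIR, where u = "?S [(2, 2 * x), (3, a), (4, y)]"])
        apply (auto simp: fun_eq_iff ay)[4]
    apply (rule exec.SEQ, rule exec_eq[OF exec_UNPAIR, where u = "?S [(2, 2 * x), (3, a), (5, b), (6, z)]"])
        apply (auto simp: fun_eq_iff bz)[4]
    apply (rule exec.SEQ, rule exec_eq[OF exec_UNPAIR, where u = "?S [(2, 2 * x), (3, a), (5, b), (7, c), (8, d)]"])
        apply (auto simp: fun_eq_iff cd)[4]
    apply (rule exec.SEQ, rule exec_eq[OF exec.INC, where u = "?S [(2, 2 * x), (3, a), (9, 1), (5, b), (7, c), (8, d)]"])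
        apply (auto simp: fun_eq_iff)[1]
    apply (rule exec.SEQ, rule exec_eq[OF exec.INC, where u = "?S [(2, 2 * x), (3, a), (9, 2), (5, b), (7, c), (8, d)]"])
        apply (auto simp: fun_eq_iff)[1]
    apply (rule exec.SEQ, rule exec_eq[OF exec_PAIR, where u = "?S [(10, ?p), (3, a), (5, b), (7, c), (8, d)]"])
        apply (auto simp: fun_eq_iff)[3]
    apply (rule exec.SEQ, rule exec_eq[OF exec_PAIR, where u = "?S [(11, ?q), (5, b), (7, c), (8, d)]"])
        apply (auto simp: fun_eq_iff)[3]
    apply (rule exec.SEQ, rule exec_eq[OF exec.INC, where u = "?S [(11, Suc ?q), (5, b), (7, c), (8, d)]"])
        apply (auto simp: fun_eq_iff)[1]
    apply (rule exec.SEQ, rule exec_eq[OF exec_PAIR, where u = "?S [(12, ?r), (7, c), (8, d)]"])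
        apply (auto simp: fun_eq_iff)[3]
    apply (rule exec.SEQ, rule exec_eq[OF exec.INC, where u = "?S [(12, Suc ?r), (7, c), (8, d)]"])
        apply (auto simp: fun_eq_iff)[1]
    apply (rule exec.SEQ, rule exec_eq[OF exec_PAIR, where u = "?S [(13, prod_encode (Suc ?r, c)), (8, d)]"])
        apply (auto simp: fun_eq_iff)[3]
    apply (rule exec_eq[OF exec_PAIR, where u = "?S [(0, fill x)]"])
        apply (auto simp: fun_eq_iff fill_def ay bz cd)[3]
    done
  then show ?thesis unfolding S0 .
qed


section \<open>The diagonal machine\<close>

definition halts :: "instr list \<Rightarrow> nat \<Rightarrow> bool" where
  "halts prog x \<longleftrightarrow> (\<exists>t. length prog \<le> fst ((rm_step prog ^^ t) (0, (\<lambda>_. 0)(0 := x))))"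

definition exit_to :: "nat \<Rightarrow> nat \<Rightarrow> nat \<Rightarrow> nat \<Rightarrow> nat" where
  "exit_to a n k pc = (if pc < n then a + pc else k)"

fun relocate :: "(nat \<Rightarrow> nat) \<Rightarrow> instr \<Rightarrow> instr" where
  "relocate f (Inc r k) = Inc r (f k)"
| "relocate f (Dec r k l) = Dec r (f k) (f l)"

text \<open>Jumps inside \<open>P\<close> are shifted and all exits lead to \<open>k\<close>, so a
  step of \<open>P\<close> inside its code is one step of \<open>prog\<close>; a halted
  \<open>P\<close> stands still and is matched by no step at all.\<close>

lemma relocate_correct:
  assumes "placed prog a (map (relocate (exit_to a (length P) k)) P)"
    and "(rm_step P ^^ t) (pc, s) = (pc', s')"
  shows "reaches prog (exit_to a (length P) k pc, s) (exit_to a (length P) k pc', s')"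
  using assms(2)
proof (induction t arbitrary: pc' s')
  case 0
  then show ?case by (simp add: reaches_refl)
next
  case (Suc t)
  obtain q u where q: "(rm_step P ^^ t) (pc, s) = (q, u)" by fastforce
  then have "rm_step P (q, u) = (pc', s')" using Suc.prems by simp
  then have "reaches prog (exit_to a (length P) k q, u) (exit_to a (length P) k pc', s')"
  proof (cases "q < length P")
    case True
    then have "a + q < length prog" "prog ! (a + q) = relocate (exit_to a (length P) k) (P ! q)"
      using assms(1) by (auto simp: placed_def)
    then have "rm_step prog (exit_to a (length P) k q, u) = (exit_to a (length P) k pc', s')"
      using \<open>rm_step P (q, u) = (pc', s')\<close> True
      by (cases "P ! q") (auto simp: exit_to_def[of _ _ _ q] split: if_splits)
    then show ?thesis by (rule reaches_step)
  qed (simp add: reaches_refl)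
  then show ?case using Suc.IH[OF q] by (rule reaches_trans[rotated])
qed

text \<open>The last instruction loops if \<open>P\<close> has returned 0, and otherwise leaves the program.\<close>

definition diagonal :: "instr list \<Rightarrow> instr list" where
  "diagonal P = (let a = code_size FILL; k = a + length P in
     compile FILL 0 a @ map (relocate (exit_to a (length P) k)) P @ [Dec 0 (Suc k) k])"

lemma halted_mono:
  assumes "length prog \<le> fst ((rm_step prog ^^ t) x)" "t \<le> u"
  shows "(rm_step prog ^^ u) x = (rm_step prog ^^ t) x"
  using assms(2)
proof (induction rule: dec_induct)
  case (step n)
  then show ?case using assms(1) by (cases "(rm_step prog ^^ t) x") simp
qed simp

lemma halts_diagonal:
  assumes "rm_computes P (fill x) y"
  shows "halts (diagonal P) x \<longleftrightarrow> y \<noteq> 0"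
proof -
  let ?a = "code_size FILL" and ?M = "diagonal P"
  let ?k = "?a + length P"
  let ?x = "(\<lambda>_. 0)(0 := x) :: nat \<Rightarrow> nat" and ?h = "(\<lambda>_. 0)(0 := fill x) :: nat \<Rightarrow> nat"
  obtain t pc s where t: "(rm_step P ^^ t) (0, ?h) = (pc, s)" "length P \<le> pc" "s 0 = y"
    using assms unfolding rm_computes_def by blast
  have "placed ?M 0 (compile FILL 0 ?a)"
    using placed_middle[of "[]"] by (simp add: diagonal_def Let_def)
  then have "reaches ?M (0, ?x) (?a, ?h)"
    using exec_FILL compile_correct by blast
  moreover have "placed ?M ?a (map (relocate (exit_to ?a (length P) ?k)) P)"
    using placed_middle[of "compile FILL 0 ?a"] by (simp add: diagonal_def Let_def)
  from relocate_correct[OF this t(1)] have "reaches ?M (?a, ?h) (?k, s)"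
    using t(2) by (simp add: exit_to_def split: if_splits)
  ultimately have "reaches ?M (0, ?x) (?k, s)"
    by (rule reaches_trans)
  then obtain u where u: "(rm_step ?M ^^ u) (0, ?x) = (?k, s)"
    unfolding reaches_def by blast
  have len: "length ?M = Suc ?k" and last: "?M ! ?k = Dec 0 (Suc ?k) ?k"
    by (simp_all add: diagonal_def Let_def nth_append)
  show ?thesis
  proof (cases "y = 0")
    case True
    then have loop: "rm_step ?M (?k, s) = (?k, s)"
      using t(3) by (simp add: len last)
    have stay: "(rm_step ?M ^^ v) (?k, s) = (?k, s)" for v
      by (induction v) (simp_all only: funpow.simps comp_apply id_apply loop)
    have "\<not> length ?M \<le> fst ((rm_step ?M ^^ v) (0, ?x))" for v
    proof
      assume v: "length ?M \<le> fst ((rm_step ?M ^^ v) (0, ?x))"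
      \<comment> \<open>At the common later time \<open>v + u\<close> the machine would be both
        halted and still at address \<open>?k\<close>.\<close>
      have "(rm_step ?M ^^ (v + u)) (0, ?x) = (rm_step ?M ^^ v) (0, ?x)"
        by (rule halted_mono[OF v]) simp
      moreover have "(rm_step ?M ^^ (v + u)) (0, ?x) = (?k, s)"
        by (simp only: funpow_add comp_apply u stay)
      ultimately have "fst ((rm_step ?M ^^ v) (0, ?x)) = ?k" by (metis fst_conv)
      then show False using v len by simp
    qed
    with True show ?thesis by (simp add: halts_def)
  next
    case False
    then have "(rm_step ?M ^^ Suc u) (0, ?x) = (Suc ?k, s(0 := s 0 - 1))"
      using t(3) u by (simp add: len last)
    then have "length ?M \<le> fst ((rm_step ?M ^^ Suc u) (0, ?x))"
      by (simp only: len fst_conv)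
    with False show ?thesis unfolding halts_def by blast
  qed
qed

section \<open>Codes of the loops and the self-referential input\<close>

lemma rat_encode_of_nat: "rat_encode (of_nat x) = prod_encode (2 * x, 2)"
proof -
  have "quotient_of (of_nat x) = (int x, 1)"
    using quotient_of_int[of "int x"] by (simp add: of_int_def)
  then show ?thesis by (simp add: rat_encode_def int_encode_def sum_encode_def)
qed

text \<open>Only the entry \<open>(0, 0)\<close> depends on \<open>x\<close>, so the codes of the
  rest of the first row and of the other rows can be computed from the matrix for input 0.\<close>

lemma mat_encode_loop_mat:
  assumes "0 < N"
  obtains a b where "\<And>x. mat_encode (loop_mat N x) =
     Suc (prod_encode (Suc (prod_encode (prod_encode (2 * x, 2), a)), b))"
proof -
  let ?row = "\<lambda>x i. map (\<lambda>j. rat_encode (loop_mat N x $$ (i, j)))"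
  let ?a = "list_encode (?row 0 0 [1..<N])"
  let ?b = "list_encode (map (\<lambda>i. list_encode (?row 0 i [0..<N])) [1..<N])"
  have "mat_encode (loop_mat N x) =
     Suc (prod_encode (Suc (prod_encode (prod_encode (2 * x, 2), ?a)), ?b))" for x
  proof -
    have entry: "loop_mat N x $$ (i, j) = loop_mat N 0 $$ (i, j)"
      if "i < N" "j < N" "i = 0 \<longrightarrow> j \<noteq> 0" for i j
      using that by (auto simp: loop_mat_def)
    have "mat_encode (loop_mat N x) = list_encode (map (\<lambda>i. list_encode (?row x i [0..<N])) [0..<N])"
      unfolding mat_encode_def mat_to_list_def by (simp add: loop_mat_def comp_def)
    also have "[0..<N] = 0 # [1..<N]" using assms by (simp add: upt_conv_Cons)
    also have "list_encode (map (\<lambda>i. list_encode (?row x i (0 # [1..<N]))) (0 # [1..<N])) =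
      Suc (prod_encode (Suc (prod_encode (rat_encode (loop_mat N x $$ (0, 0)), list_encode (?row x 0 [1..<N]))),
        list_encode (map (\<lambda>i. list_encode (?row x i (0 # [1..<N]))) [1..<N])))"
      by simp
    also have "loop_mat N x $$ (0, 0) = of_nat x" using assms by (simp add: loop_mat_def)
    also have "?row x 0 [1..<N] = ?row 0 0 [1..<N]"
      by (rule map_cong) (auto simp: entry)
    also have "map (\<lambda>i. list_encode (?row x i (0 # [1..<N]))) [1..<N] =
        map (\<lambda>i. list_encode (?row 0 i (0 # [1..<N]))) [1..<N]"
      by (intro map_cong arg_cong[of _ _ list_encode]) (auto simp: entry)
    also have "0 # [1..<N] = [0..<N]" using assms by (simp add: upt_conv_Cons)
    finally show ?thesis by (simp only: rat_encode_of_nat)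
  qed
  then show thesis by (rule that)
qed

text \<open>The parts of the code other than the entry \<open>(0, 0)\<close> are independent of
  \<open>x\<close>. Hence \<open>x\<close> can be defined from them without circularity, and
  \<open>fill\<close> then inserts \<open>x\<close> itself.\<close>

lemma fill_loop_encode:
  assumes "0 < N"
  obtains x where "fill x = loop_encode N (loop_mat N x) Ps"
proof -
  obtain a b where ab: "\<And>x. mat_encode (loop_mat N x) =
     Suc (prod_encode (Suc (prod_encode (prod_encode (2 * x, 2), a)), b))"
    using mat_encode_loop_mat[OF assms] by blast
  show thesis
    by (rule that[of "prod_encode (a, prod_encode (b, prod_encode (list_encode (map (mpoly_encode N) Ps), N)))"])
      (simp add: fill_def loop_encode_def ab)
qed

section \<open>Binomial coefficients modulo two\<close>

text \<open>One binary digit of Lucas' theorem. Pascal's rule gives row \<open>2 * a + 2\<close>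
  from row \<open>2 * a + 1\<close>, where the summands in odd columns have equal parity and cancel,
  and then row \<open>2 * a + 3\<close> from row \<open>2 * a + 2\<close>.\<close>

lemma odd_choose_double:
  "(odd ((2 * a) choose (2 * b)) \<longleftrightarrow> odd (a choose b)) \<and> even ((2 * a) choose (2 * b + 1)) \<and>
   (odd ((2 * a + 1) choose (2 * b)) \<longleftrightarrow> odd (a choose b)) \<and>
   (odd ((2 * a + 1) choose (2 * b + 1)) \<longleftrightarrow> odd (a choose b))"
proof (induction a arbitrary: b)
  case 0
  show ?case by (cases b) auto
next
  case (Suc a)
  have S: "2 * Suc a = Suc (2 * a + 1)" by simp
  have e: "odd ((2 * Suc a) choose (2 * b)) \<longleftrightarrow> odd (Suc a choose b)" for b
  proof (cases b)
    case (Suc d)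
    have "2 * Suc d = Suc (2 * d + 1)" by simp
    then have "(2 * Suc a) choose (2 * b) = ((2 * a + 1) choose (2 * d + 1)) + ((2 * a + 1) choose (2 * Suc d))"
      unfolding Suc S by (simp only: binomial_Suc_Suc)
    then show ?thesis using Suc.IH[of d] Suc.IH[of "Suc d"] Suc by simp
  qed simp
  have o: "even ((2 * Suc a) choose (2 * b + 1))" for b
  proof -
    have "(2 * Suc a) choose (2 * b + 1) = ((2 * a + 1) choose (2 * b)) + ((2 * a + 1) choose (2 * b + 1))"
      unfolding S by (simp only: Suc_eq_plus1[symmetric] binomial_Suc_Suc)
    then show ?thesis using Suc.IH[of b] by simp
  qed
  have "odd ((2 * Suc a + 1) choose (2 * b)) \<longleftrightarrow> odd (Suc a choose b)"
  proof (cases b)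
    case (Suc d)
    have "2 * Suc d = Suc (2 * d + 1)" by simp
    then have "(2 * Suc a + 1) choose (2 * b) = ((2 * Suc a) choose (2 * d + 1)) + ((2 * Suc a) choose (2 * b))"
      unfolding Suc by (simp only: Suc_eq_plus1[symmetric] binomial_Suc_Suc)
    then show ?thesis using e[of b] o[of d] by simp
  qed simp
  moreover have "(2 * Suc a + 1) choose (2 * b + 1) = ((2 * Suc a) choose (2 * b)) + ((2 * Suc a) choose (2 * b + 1))"
    by (simp only: Suc_eq_plus1[symmetric] binomial_Suc_Suc)
  ultimately show ?case using e[of b] o[of b] by simp
qed

lemma odd_choose_div2:
  "odd (s choose r) \<longleftrightarrow> odd ((s div 2) choose (r div 2)) \<and> r mod 2 \<le> s mod 2"
proof -
  obtain a where a: "s = 2 * a \<or> s = 2 * a + 1" by (metis evenE oddE)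
  obtain b where b: "r = 2 * b \<or> r = 2 * b + 1" by (metis evenE oddE)
  show ?thesis
    using a b odd_choose_double[of a b] by (elim disjE) simp_all
qed

text \<open>Oddness compares the binary digits of both numbers one by one, so blocks of
  \<open>e\<close> bits can be compared separately.\<close>

lemma odd_choose_power2_split:
  assumes "r < 2 ^ e" "s < 2 ^ e"
  shows "odd ((2 ^ e * s' + s) choose (2 ^ e * r' + r)) \<longleftrightarrow> odd (s' choose r') \<and> odd (s choose r)"
  using assms
proof (induction e arbitrary: r s)
  case (Suc e)
  have "(2 ^ Suc e * q + p) div 2 = 2 ^ e * q + p div 2" "(2 ^ Suc e * q + p) mod 2 = p mod 2" for q p :: nat
  proof -
    have "2 ^ Suc e * q + p = p + 2 * (2 ^ e * q)" by simp
    then show "(2 ^ Suc e * q + p) div 2 = 2 ^ e * q + p div 2" "(2 ^ Suc e * q + p) mod 2 = p mod 2"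
      by (simp_all only: div_mult_self2 mod_mult_self2)
  qed
  moreover have "r div 2 < 2 ^ e" "s div 2 < 2 ^ e" using Suc.prems by auto
  ultimately show ?case
    using Suc.IH[of "r div 2" "s div 2"] odd_choose_div2[of s r]
    by (subst odd_choose_div2) (simp only:, blast)
qed simp

lemma odd_choose_ones: "r < 2 ^ e \<Longrightarrow> odd ((2 ^ e - 1) choose r)"
proof (induction e arbitrary: r)
  case (Suc e)
  have "(2 ^ Suc e - 1 :: nat) = 2 * (2 ^ e - 1) + 1"
    using one_le_power[of "2::nat" e] unfolding power_Suc by linarith
  then have "(2 ^ Suc e - 1 :: nat) div 2 = 2 ^ e - 1" "(2 ^ Suc e - 1 :: nat) mod 2 = 1" by simp_all
  moreover have "r div 2 < 2 ^ e" using Suc.prems by auto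
  ultimately show ?case
    using Suc.IH[of "r div 2"] by (subst odd_choose_div2) (simp only:, simp)
qed simp

lemma odd_binomial_split:
  fixes r s r' s' :: int
  assumes "0 \<le> r" "r < 2 ^ e" "0 \<le> s" "s < 2 ^ e" "0 \<le> r'" "0 \<le> s'"
  shows "odd_binomial (r + 2 ^ e * r') (s + 2 ^ e * s') \<longleftrightarrow> odd_binomial r s \<and> odd_binomial r' s'"
proof -
  obtain r0 s0 r1 s1 where n: "r = int r0" "s = int s0" "r' = int r1" "s' = int s1"
    using assms by (metis nonneg_int_cases)
  have lt: "r0 < 2 ^ e" "s0 < 2 ^ e"
    using assms(2,4) unfolding n by (simp_all flip: of_nat_less_iff)
  have "r + 2 ^ e * r' = int (2 ^ e * r1 + r0)" "s + 2 ^ e * s' = int (2 ^ e * s1 + s0)"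
    by (simp_all add: n)
  then show ?thesis
    unfolding odd_binomial_def n using odd_choose_power2_split[OF lt, of s1 r1] by (simp only: nat_int) auto
qed

lemma odd_binomial_0: "odd_binomial r 0 \<longleftrightarrow> r = 0"
  by (cases "nat r") (auto simp: odd_binomial_def)

lemma odd_binomial_ones:
  assumes "d \<in> {0, 1}"
  shows "odd_binomial r ((2 ^ e - 1) * d) \<longleftrightarrow> 0 \<le> r \<and> r \<le> (2 ^ e - 1) * d"
proof (cases "d = 0")
  case True
  with True show ?thesis by (auto simp: odd_binomial_0)
next
  case False
  then have d: "d = 1" using assms by simp
  have one: "(2::int) ^ e - 1 = int (2 ^ e - 1)" by (simp add: of_nat_diff)
  show ?thesis
  proof (cases "0 \<le> r")
    case True
    then obtain n where n: "r = int n" by (rule nonneg_int_cases)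
    have "odd ((2 ^ e - 1) choose n) \<longleftrightarrow> n \<le> 2 ^ e - 1"
    proof (cases "n \<le> 2 ^ e - 1")
      case True
      moreover have "(0::nat) < 2 ^ e" by simp
      ultimately have "n < 2 ^ e" by linarith
      then show ?thesis using odd_choose_ones True by blast
    qed (simp add: binomial_eq_0)
    then show ?thesis unfolding d one n odd_binomial_def by (simp del: of_nat_diff)
  qed (simp add: odd_binomial_def)
qed

section \<open>Expansions in a power of two as base\<close>

lemma sum_power_shift:
  fixes b :: int
  shows "(\<Sum>t<Suc k. f t * b ^ t) = f 0 + b * (\<Sum>t<k. f (Suc t) * b ^ t)"
  by (simp only: sum.lessThan_Suc_shift sum_distrib_left) (simp add: mult_ac)

text \<open>Parity is a bitwise comparison, and \<open>e \<le> c\<close> keeps the ones of the mask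
  for a digit inside its block of \<open>c\<close> bits. The blocks are peeled off from the lowest
  one by \<open>odd_binomial_split\<close>.\<close>

lemma odd_binomial_digits:
  fixes c :: nat
  defines "b \<equiv> (2::int) ^ c"
  assumes "e \<le> c" "\<And>t. t < k \<Longrightarrow> \<epsilon> t \<in> {0, 1}"
  shows "odd_binomial X ((2 ^ e - 1) * (\<Sum>t<k. \<epsilon> t * b ^ t)) \<longleftrightarrow>
    (\<exists>d. (\<forall>t<k. 0 \<le> d t \<and> d t \<le> (2 ^ e - 1) * \<epsilon> t) \<and> X = (\<Sum>t<k. d t * b ^ t))"
  using assms(3)
proof (induction k arbitrary: X \<epsilon>)
  case 0
  show ?case by (simp add: odd_binomial_0)
next
  case (Suc k)
  let ?M = "(2::int) ^ e - 1"
  let ?E = "\<Sum>t<k. \<epsilon> (Suc t) * b ^ t"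
  have b: "b > 0" by (simp add: b_def)
  have "(2::int) ^ e \<le> b" unfolding b_def using assms(2) by (intro power_increasing) auto
  then have M: "0 \<le> ?M" "?M < b" by simp_all
  have \<epsilon>: "\<epsilon> 0 \<in> {0, 1}" "\<And>t. t < k \<Longrightarrow> \<epsilon> (Suc t) \<in> {0, 1}" using Suc.prems by auto
  have low: "0 \<le> ?M * \<epsilon> 0" "?M * \<epsilon> 0 < b" using \<epsilon>(1) M b by auto
  have E: "0 \<le> ?M * ?E" using M \<epsilon>(2) b by (intro mult_nonneg_nonneg sum_nonneg) fastforce+
  have split: "?M * (\<Sum>t<Suc k. \<epsilon> t * b ^ t) = ?M * \<epsilon> 0 + b * (?M * ?E)"
    unfolding sum_power_shift by (simp add: algebra_simps)
  have IH: "odd_binomial Y (?M * ?E) \<longleftrightarrow>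
      (\<exists>d. (\<forall>t<k. 0 \<le> d t \<and> d t \<le> ?M * \<epsilon> (Suc t)) \<and> Y = (\<Sum>t<k. d t * b ^ t))" for Y
    by (rule Suc.IH) (rule \<epsilon>(2))
  show ?case
  proof
    assume *: "odd_binomial X (?M * (\<Sum>t<Suc k. \<epsilon> t * b ^ t))"
    then have X: "0 \<le> X" by (simp add: odd_binomial_def)
    have "odd_binomial (X mod b + b * (X div b)) (?M * \<epsilon> 0 + b * (?M * ?E))"
      using * unfolding split by simp
    then have parts: "odd_binomial (X mod b) (?M * \<epsilon> 0)" "odd_binomial (X div b) (?M * ?E)"
      using odd_binomial_split[of "X mod b" c "?M * \<epsilon> 0" "X div b" "?M * ?E"] X low E b
      by (auto simp: b_def pos_imp_zdiv_nonneg_iff)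
    obtain d where d: "\<forall>t<k. 0 \<le> d t \<and> d t \<le> ?M * \<epsilon> (Suc t)" "X div b = (\<Sum>t<k. d t * b ^ t)"
      using iffD1[OF IH parts(2)] by (elim exE conjE) (rule that)
    have d0: "0 \<le> X mod b" "X mod b \<le> ?M * \<epsilon> 0"
      using parts(1) unfolding odd_binomial_ones[OF \<epsilon>(1)] by simp_all
    \<comment> \<open>The lowest digit is put in front of those of the quotient.\<close>
    let ?d = "case_nat (X mod b) d"
    have "X = X mod b + b * (X div b)" by simp
    also have "\<dots> = (\<Sum>t<Suc k. ?d t * b ^ t)" unfolding sum_power_shift d(2) by simp
    finally have "X = (\<Sum>t<Suc k. ?d t * b ^ t)" .
    moreover have "\<forall>t<Suc k. 0 \<le> ?d t \<and> ?d t \<le> ?M * \<epsilon> t"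
      using d(1) d0 by (auto split: nat.split)
    ultimately show "\<exists>d. (\<forall>t<Suc k. 0 \<le> d t \<and> d t \<le> ?M * \<epsilon> t) \<and> X = (\<Sum>t<Suc k. d t * b ^ t)"
      by (intro exI[of _ ?d] conjI)
  next
    assume "\<exists>d. (\<forall>t<Suc k. 0 \<le> d t \<and> d t \<le> ?M * \<epsilon> t) \<and> X = (\<Sum>t<Suc k. d t * b ^ t)"
    then obtain d where d: "\<And>t. t < Suc k \<Longrightarrow> 0 \<le> d t \<and> d t \<le> ?M * \<epsilon> t"
      and X: "X = (\<Sum>t<Suc k. d t * b ^ t)" by blast
    let ?X = "\<Sum>t<k. d (Suc t) * b ^ t"
    have "odd_binomial ?X (?M * ?E)"
      using d by (intro iffD2[OF IH] exI[of _ "\<lambda>t. d (Suc t)"]) auto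
    moreover have "odd_binomial (d 0) (?M * \<epsilon> 0)" unfolding odd_binomial_ones[OF \<epsilon>(1)] using d by auto
    moreover have "0 \<le> ?X" using d b by (intro sum_nonneg mult_nonneg_nonneg) auto
    moreover have "0 \<le> d 0" "d 0 < b" using d[of 0] low by auto
    ultimately have "odd_binomial (d 0 + b * ?X) (?M * \<epsilon> 0 + b * (?M * ?E))"
      unfolding b_def using low E by (subst odd_binomial_split) (auto simp: b_def)
    then show "odd_binomial X (?M * (\<Sum>t<Suc k. \<epsilon> t * b ^ t))"
      unfolding split unfolding X sum_power_shift .
  qed
qed

text \<open>The lowest digit is a multiple of the base but smaller in absolute value, hence 0, and
  the base can be divided out. The leading coefficient \<open>D\<close> may have any size.\<close>

lemma small_digits_zero:
  fixes b :: int
  assumes "(\<Sum>t<k. \<delta> t * b ^ t) + D * b ^ k = 0" "\<And>t. t < k \<Longrightarrow> \<bar>\<delta> t\<bar> < b" "b > 0"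
  shows "D = 0 \<and> (\<forall>t<k. \<delta> t = 0)"
  using assms(1,2)
proof (induction k arbitrary: \<delta>)
  case (Suc k)
  let ?r = "(\<Sum>t<k. \<delta> (Suc t) * b ^ t) + D * b ^ k"
  have eq: "\<delta> 0 + b * ?r = 0"
    using Suc.prems(1) unfolding sum_power_shift by (simp add: algebra_simps)
  then have "\<delta> 0 = b * (- ?r)" by (simp only: mult_minus_right eq_neg_iff_add_eq_0)
  then have "b dvd \<delta> 0" by (rule dvdI)
  then have z: "\<delta> 0 = 0" using Suc.prems(2)[of 0] dvd_imp_le_int[of "\<delta> 0" b] by auto
  with eq assms(3) have "?r = 0" by simp
  then have "D = 0 \<and> (\<forall>t<k. \<delta> (Suc t) = 0)"
    using Suc.prems(2) by (intro Suc.IH) auto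
  with z show ?case by (auto simp: less_Suc_eq_0_disj)
qed simp

text \<open>Multiplication by the base shifts digits by one time step, so a recurrence with initial
  value \<open>a0\<close> becomes a single equation between numbers. The coefficients at
  \<open>b ^ k\<close> form the unbounded leading term of \<open>small_digits_zero\<close>, which is
  why \<open>a k\<close> may be large.\<close>

lemma shifted_digits:
  fixes b :: int
  assumes "(\<Sum>t<k. a t * b ^ t) + a k * b ^ k = a0 + b * (\<Sum>t<k. w t * b ^ t)"
    and "k > 0 \<Longrightarrow> \<bar>a 0 - a0\<bar> < b" "\<And>t. Suc t < k \<Longrightarrow> \<bar>a (Suc t) - w t\<bar> < b" "b > 0"
  shows "a 0 = a0" "t < k \<Longrightarrow> a (Suc t) = w t"
proof -
  let ?w = "case_nat a0 w"
  have "a0 + b * (\<Sum>t<k. w t * b ^ t) = (\<Sum>t<Suc k. ?w t * b ^ t)"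
    unfolding sum_power_shift by simp
  then have "(\<Sum>t<k. (a t - ?w t) * b ^ t) + (a k - ?w k) * b ^ k = 0"
    using assms(1) by (simp add: left_diff_distrib sum_subtractf)
  then have "a k - ?w k = 0 \<and> (\<forall>t<k. a t - ?w t = 0)"
    using assms(2-4) by (intro small_digits_zero[where b = b]) (auto split: nat.split)
  then have all: "a t = ?w t" if "t \<le> k" for t
    using that by (cases "t = k") auto
  from all[of 0] show "a 0 = a0" by simp
  from all[of "Suc t"] show "t < k \<Longrightarrow> a (Suc t) = w t" by simp
qed

section \<open>Arithmetisation of halting\<close>

fun target :: "instr \<Rightarrow> nat" where
  "target (Inc r k) = k"
| "target (Dec r k l) = k"

text \<open>For an increment the value is a dummy; both \<open>trace\<close> and
  \<open>equations\<close> make \<open>G\<close> vanish there.\<close>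

fun zero_target :: "instr \<Rightarrow> nat" where
  "zero_target (Inc r k) = k"
| "zero_target (Dec r k l) = l"

fun register :: "instr \<Rightarrow> nat" where
  "register (Inc r k) = r"
| "register (Dec r k l) = r"

fun is_dec :: "instr \<Rightarrow> bool" where
  "is_dec (Inc r k) \<longleftrightarrow> False"
| "is_dec (Dec r k l) \<longleftrightarrow> True"

definition effect :: "instr \<Rightarrow> nat \<Rightarrow> int" where
  "effect i j = (if register i = j then if is_dec i then -1 else 1 else 0)"

text \<open>Being linear in \<open>F\<close> and \<open>G\<close>, the expression serves both for
  the flags of a single time and for the numbers having these flags as digits.\<close>

definition flow :: "instr list \<Rightarrow> (nat \<Rightarrow> int) \<Rightarrow> (nat \<Rightarrow> int) \<Rightarrow> nat \<Rightarrow> int" where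
  "flow prog F G i = (\<Sum>p<length prog. (if target (prog ! p) = i then F p else 0) +
     (if zero_target (prog ! p) = i then G p else 0))"

definition change :: "instr list \<Rightarrow> (nat \<Rightarrow> int) \<Rightarrow> nat \<Rightarrow> int" where
  "change prog F j = (\<Sum>p<length prog. effect (prog ! p) j * F p)"

text \<open>
  \<open>F p t = 1\<close> if instruction \<open>p\<close> is executed at time \<open>t\<close> without taking its zero branch,
  \<open>G p t = 1\<close> if it is executed and takes the zero branch; \<open>R j t\<close> is the content of register \<open>j\<close>.
\<close>

locale trace =
  fixes prog :: "instr list" and m x k :: nat and F G R :: "nat \<Rightarrow> nat \<Rightarrow> int"
  assumes branch: "p < length prog \<Longrightarrow> t < k \<Longrightarrow> F p t \<in> {0, 1} \<and> G p t \<in> {0, 1}"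
    and halted: "p < length prog \<Longrightarrow> F p k = 0 \<and> G p k = 0"
    and one: "t < k \<Longrightarrow> (\<Sum>p<length prog. F p t + G p t) = 1"
    and inc: "p < length prog \<Longrightarrow> t < k \<Longrightarrow> \<not> is_dec (prog ! p) \<Longrightarrow> G p t = 0"
    and pc_0: "p < length prog \<Longrightarrow> F p 0 + G p 0 = (if p = 0 then 1 else 0)"
    and pc_Suc: "p < length prog \<Longrightarrow> t < k \<Longrightarrow>
      F p (Suc t) + G p (Suc t) = flow prog (\<lambda>p. F p t) (\<lambda>p. G p t) p"
    and reg_0: "j < m \<Longrightarrow> R j 0 = (if j = 0 then int x else 0)"
    and reg_Suc: "j < m \<Longrightarrow> t < k \<Longrightarrow> R j (Suc t) = R j t + change prog (\<lambda>p. F p t) j"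
    and reg_nonneg: "j < m \<Longrightarrow> t \<le> k \<Longrightarrow> 0 \<le> R j t"
    and zero_test: "p < length prog \<Longrightarrow> t < k \<Longrightarrow> is_dec (prog ! p) \<Longrightarrow> G p t = 1 \<Longrightarrow>
      R (register (prog ! p)) t = 0"

section \<open>Traces and runs of the machine\<close>

lemma rm_step_eq:
  assumes "pc < length prog"
  shows "rm_step prog (pc, s) = (let i = prog ! pc; r = register i in
     if is_dec i \<and> s r = 0 then (zero_target i, s)
     else (target i, s(r := if is_dec i then s r - 1 else Suc (s r))))"
  using assms by (cases "prog ! pc") (simp_all add: Let_def)

declare rm_step.simps [simp del]

lemma flow_single:
  assumes "pc < length prog"
    and "\<And>p. p < length prog \<Longrightarrow> F p = (if p = pc \<and> \<not> z then 1 else 0)"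
    and "\<And>p. p < length prog \<Longrightarrow> G p = (if p = pc \<and> z then 1 else 0)"
  shows "flow prog F G i = (if (if z then zero_target (prog ! pc) else target (prog ! pc)) = i then 1 else 0)"
proof -
  have "flow prog F G i = (\<Sum>p<length prog. (if p = pc then
      if (if z then zero_target (prog ! pc) else target (prog ! pc)) = i then 1 else 0 else 0))"
    unfolding flow_def by (rule sum.cong) (auto simp: assms(2,3))
  then show ?thesis using assms(1) by simp
qed

lemma change_single:
  assumes "pc < length prog"
    and "\<And>p. p < length prog \<Longrightarrow> F p = (if p = pc \<and> \<not> z then 1 else 0)"
  shows "change prog F j = (if z then 0 else effect (prog ! pc) j)"
proof -
  have "change prog F j = (\<Sum>p<length prog. (if p = pc then if z then 0 else effect (prog ! pc) j else 0))"
    unfolding change_def by (rule sum.cong) (auto simp: assms(2))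
  then show ?thesis using assms(1) by simp
qed

text \<open>By induction on time the flags and registers describe the actual configuration: one flag
  is set, and the register conditions leave no choice of the branch.\<close>

lemma (in trace) halts:
  assumes regs: "\<And>p. p < length prog \<Longrightarrow> register (prog ! p) < m"
  shows "halts prog x"
proof -
  let ?L = "length prog"
  define cfg where "cfg t = (rm_step prog ^^ t) (0, (\<lambda>_. 0)(0 := x))" for t
  have cfg_Suc: "cfg (Suc t) = rm_step prog (cfg t)" for t
    by (simp add: cfg_def)
  have "(\<forall>j<m. R j t = int (snd (cfg t) j)) \<and>
      (\<forall>p<?L. F p t + G p t = (if p = fst (cfg t) then 1 else 0))" if "t \<le> k" for t
    using that
  proof (induction t)
    case 0
    then show ?case using pc_0 reg_0 by (simp add: cfg_def)
  next
    case (Suc t)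
    then have t: "t < k" by simp
    obtain pc s where cfg: "cfg t = (pc, s)" by fastforce
    have R: "R j t = int (s j)" if "j < m" for j using Suc cfg that by simp
    have E: "F p t + G p t = (if p = pc then 1 else 0)" if "p < ?L" for p using Suc cfg that by simp
    have pc: "pc < ?L"
    proof (rule ccontr)
      assume "\<not> pc < ?L"
      then have "(\<Sum>p<?L. F p t + G p t) = 0" using E by (intro sum.neutral) auto
      then show False using one[OF t] by simp
    qed
    define z where "z \<longleftrightarrow> G pc t = 1"
    have F: "F p t = (if p = pc \<and> \<not> z then 1 else 0)" and G: "G p t = (if p = pc \<and> z then 1 else 0)"
      if "p < ?L" for p
      using branch[OF that t] branch[OF pc t] E[OF that] by (auto simp: z_def split: if_splits)
    let ?i = "prog ! pc"
    let ?r = "register ?i"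
    have fl: "flow prog (\<lambda>p. F p t) (\<lambda>p. G p t) p =
        (if (if z then zero_target ?i else target ?i) = p then 1 else 0)" for p
      by (rule flow_single[OF pc F G])
    have ch: "change prog (\<lambda>p. F p t) j = (if z then 0 else effect ?i j)" for j
      by (rule change_single[OF pc F])
    have z: "z \<longleftrightarrow> is_dec ?i \<and> s ?r = 0"
    proof
      assume z: z
      then have "is_dec ?i" using inc[OF pc t] by (auto simp: z_def)
      then show "is_dec ?i \<and> s ?r = 0"
        using zero_test[OF pc t] R[OF regs[OF pc]] z by (auto simp: z_def)
    next
      assume *: "is_dec ?i \<and> s ?r = 0"
      show z
      proof (rule ccontr)
        assume "\<not> z"
        \<comment> \<open>Decrementing an empty register would leave -1, so nonnegativity forces the
          zero branch.\<close>
        then have "R ?r (Suc t) = -1"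
          using reg_Suc[OF regs[OF pc] t] R[OF regs[OF pc]] * ch by (simp add: effect_def)
        then show False using reg_nonneg[OF regs[OF pc], of "Suc t"] t by simp
      qed
    qed
    have step: "cfg (Suc t) = (if z then (zero_target ?i, s)
        else (target ?i, s(?r := if is_dec ?i then s ?r - 1 else Suc (s ?r))))"
      using rm_step_eq[OF pc] by (simp add: cfg_Suc cfg z Let_def)
    have "R j (Suc t) = int (snd (cfg (Suc t)) j)" if "j < m" for j
      using reg_Suc[OF that t] R[OF that] ch[of j] z unfolding step by (auto simp: effect_def)
    moreover have "F p (Suc t) + G p (Suc t) = (if p = fst (cfg (Suc t)) then 1 else 0)" if "p < ?L" for p
      using pc_Suc[OF that t] fl[of p] unfolding step by auto
    ultimately show ?case by blast
  qed
  \<comment> \<open>At time \<open>k\<close> no flag is set, so the program counter is no address of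
    the program.\<close>
  from this[of k] halted have "\<not> fst (cfg k) < ?L" by force
  then show ?thesis unfolding halts_def cfg_def by (meson not_le)
qed

lemma halts_trace:
  assumes "halts prog x"
  obtains k F G R where "trace prog m x k F G R"
proof -
  let ?L = "length prog"
  let ?cfg = "\<lambda>t. (rm_step prog ^^ t) (0, (\<lambda>_. 0)(0 := x))"
  \<comment> \<open>Minimality of \<open>k\<close> keeps the program counter inside the program at
    all earlier times.\<close>
  define k where "k = (LEAST t. ?L \<le> fst (?cfg t))"
  have k: "?L \<le> fst (?cfg k)"
    using assms unfolding halts_def k_def by (rule LeastI_ex)
  have run: "fst (?cfg t) < ?L" if "t < k" for t
    using not_less_Least[of t "\<lambda>t. ?L \<le> fst (?cfg t)"] that unfolding k_def by simp
  define z where "z t \<longleftrightarrow> is_dec (prog ! fst (?cfg t)) \<and> snd (?cfg t) (register (prog ! fst (?cfg t))) = 0" for t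
  define F :: "nat \<Rightarrow> nat \<Rightarrow> int" where "F p t = (if p = fst (?cfg t) \<and> \<not> z t then 1 else 0)" for p t
  define G :: "nat \<Rightarrow> nat \<Rightarrow> int" where "G p t = (if p = fst (?cfg t) \<and> z t then 1 else 0)" for p t
  define R where "R j t = int (snd (?cfg t) j)" for j t
  have FG: "F p t + G p t = (if p = fst (?cfg t) then 1 else 0)" for p t
    by (auto simp: F_def G_def)
  have step: "?cfg (Suc t) = (let i = prog ! fst (?cfg t); r = register i; s = snd (?cfg t) in
      if z t then (zero_target i, s) else (target i, s(r := if is_dec i then s r - 1 else Suc (s r))))"
    if "t < k" for t
    using rm_step_eq[OF run[OF that], of "snd (?cfg t)"] by (simp add: z_def Let_def)
  have fl: "flow prog (\<lambda>p. F p t) (\<lambda>p. G p t) p = (if p = fst (?cfg (Suc t)) then 1 else 0)" if "t < k" for p t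
    using flow_single[OF run[OF that], of "\<lambda>p. F p t" "z t" "\<lambda>p. G p t" p]
    unfolding step[OF that] by (auto simp: F_def G_def Let_def)
  have ch: "change prog (\<lambda>p. F p t) j = R j (Suc t) - R j t" if "t < k" for j t
    using change_single[OF run[OF that], of "\<lambda>p. F p t" "z t" j]
    unfolding R_def step[OF that] by (auto simp: F_def Let_def effect_def z_def)
  have "trace prog m x k F G R"
  proof
    show "(\<Sum>p<?L. F p t + G p t) = 1" if "t < k" for t
      unfolding FG using run[OF that] by simp
    show "F p (Suc t) + G p (Suc t) = flow prog (\<lambda>p. F p t) (\<lambda>p. G p t) p" if "t < k" for p t
      unfolding FG fl[OF that] ..
    show "R j (Suc t) = R j t + change prog (\<lambda>p. F p t) j" if "t < k" for j t
      unfolding ch[OF that] by simp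
    show "F p 0 + G p 0 = (if p = 0 then 1 else 0)" for p
      unfolding FG by simp
  qed (use k in \<open>auto simp: F_def G_def R_def z_def split: if_splits\<close>)
  then show thesis by (rule that)
qed

text \<open>
  The base of the digits is \<open>2 * h\<close> with \<open>h\<close> a power of two, \<open>B\<close> is intended to be \<open>(2 * h) ^ k\<close> for a
  run of \<open>k\<close> steps, \<open>U\<close> has all \<open>k\<close> digits equal to 1, and \<open>f j\<close> is the final content of register \<open>j\<close>.
\<close>

definition equations :: "instr list \<Rightarrow> nat \<Rightarrow> int \<Rightarrow> int \<Rightarrow> int \<Rightarrow> int \<Rightarrow> (nat \<Rightarrow> int) \<Rightarrow> (nat \<Rightarrow> int) \<Rightarrow>
    (nat \<Rightarrow> int) \<Rightarrow> (nat \<Rightarrow> int) \<Rightarrow> bool" where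
  "equations prog m x h B U F G R f \<longleftrightarrow>
     U * (2 * h - 1) = B - 1 \<and> x < 2 * h \<and> int (length prog) < h \<and>
     (\<forall>p<length prog. odd_binomial (F p) U \<and> odd_binomial (G p) U \<and>
        F p + G p = (if p = 0 then 1 else 0) + 2 * h * flow prog F G p) \<and>
     (\<forall>p<length prog. if is_dec (prog ! p)
        then odd_binomial (R (register (prog ! p))) ((h - 1) * (U - G p)) else G p = 0) \<and>
     (\<Sum>p<length prog. F p + G p) = U \<and>
     (\<forall>j<m. odd_binomial (R j) ((h - 1) * U) \<and> 0 \<le> f j \<and>
        R j + f j * B = (if j = 0 then x else 0) + 2 * h * (R j + change prog F j))"

section \<open>Passing between traces and equations\<close>

lemma flow_digits:
  "flow prog (\<lambda>p. \<Sum>t<k. F p t * b ^ t) (\<lambda>p. \<Sum>t<k. G p t * b ^ t) i =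
     (\<Sum>t<k. flow prog (\<lambda>p. F p t) (\<lambda>p. G p t) i * b ^ t)"
proof -
  have "flow prog (\<lambda>p. \<Sum>t<k. F p t * b ^ t) (\<lambda>p. \<Sum>t<k. G p t * b ^ t) i =
    (\<Sum>p<length prog. \<Sum>t<k. ((if target (prog ! p) = i then F p t else 0) +
       (if zero_target (prog ! p) = i then G p t else 0)) * b ^ t)"
    unfolding flow_def by (rule sum.cong) (auto simp: sum.distrib distrib_right)
  also have "\<dots> = (\<Sum>t<k. flow prog (\<lambda>p. F p t) (\<lambda>p. G p t) i * b ^ t)"
    unfolding flow_def sum_distrib_right by (rule sum.swap)
  finally show ?thesis .
qed

lemma change_digits:
  "change prog (\<lambda>p. \<Sum>t<k. F p t * b ^ t) j = (\<Sum>t<k. change prog (\<lambda>p. F p t) j * b ^ t)"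
proof -
  have "change prog (\<lambda>p. \<Sum>t<k. F p t * b ^ t) j =
      (\<Sum>p<length prog. \<Sum>t<k. effect (prog ! p) j * F p t * b ^ t)"
    unfolding change_def sum_distrib_left by (simp add: mult_ac)
  also have "\<dots> = (\<Sum>t<k. change prog (\<lambda>p. F p t) j * b ^ t)"
    unfolding change_def sum_distrib_right by (rule sum.swap)
  finally show ?thesis .
qed

lemma repunit_eq_iff:
  fixes b :: int
  assumes "b > 1"
  shows "U * (b - 1) = b ^ k - 1 \<longleftrightarrow> U = (\<Sum>t<k. b ^ t)"
proof -
  have "(\<Sum>t<k. b ^ t) * (b - 1) = b ^ k - 1"
    by (metis power_diff_1_eq mult.commute)
  then show ?thesis using assms
    by (metis mult_cancel_right diff_eq_eq add_0 less_irrefl)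
qed


lemma flow_bounds:
  assumes "\<And>p. p < length prog \<Longrightarrow> 0 \<le> F p \<and> F p \<le> 1" "\<And>p. p < length prog \<Longrightarrow> 0 \<le> G p \<and> G p \<le> 1"
  shows "0 \<le> flow prog F G i" "flow prog F G i \<le> 2 * int (length prog)"
proof -
  show "0 \<le> flow prog F G i"
    unfolding flow_def using assms by (intro sum_nonneg) auto
  have "flow prog F G i \<le> (\<Sum>p<length prog. 2)"
    unfolding flow_def by (rule sum_mono) (use assms in \<open>force split: if_splits\<close>)
  then show "flow prog F G i \<le> 2 * int (length prog)" by simp
qed

lemma change_bound:
  assumes "\<And>p. p < length prog \<Longrightarrow> 0 \<le> F p \<and> F p \<le> 1"
  shows "\<bar>change prog F j\<bar> \<le> int (length prog)"
proof -
  have "\<bar>change prog F j\<bar> \<le> (\<Sum>p<length prog. \<bar>effect (prog ! p) j * F p\<bar>)"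
    unfolding change_def by (rule sum_abs)
  also have "\<dots> \<le> (\<Sum>p<length prog. 1)"
    by (rule sum_mono) (use assms in \<open>auto simp: effect_def\<close>)
  finally show ?thesis by simp
qed

text \<open>The mask \<open>h - 1\<close> fills \<open>c\<close> of the \<open>c + 1\<close> bits of
  a digit, the number with all digits 1 only the lowest. The free top bit leaves room for adding the
  change of one step to a register digit.\<close>

lemma odd_binomial_power_digits:
  fixes h b :: int
  assumes h: "h = 2 ^ c" and b: "b = 2 * h"
  shows "(\<And>t. t < k \<Longrightarrow> \<epsilon> t \<in> {0, 1}) \<Longrightarrow>
      odd_binomial X ((h - 1) * (\<Sum>t<k. \<epsilon> t * b ^ t)) \<longleftrightarrow>
      (\<exists>d. (\<forall>t<k. 0 \<le> d t \<and> d t \<le> (h - 1) * \<epsilon> t) \<and> X = (\<Sum>t<k. d t * b ^ t))"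
    and "odd_binomial X (\<Sum>t<k. b ^ t) \<longleftrightarrow>
      (\<exists>d. (\<forall>t<k. 0 \<le> d t \<and> d t \<le> 1) \<and> X = (\<Sum>t<k. d t * b ^ t))"
proof -
  have b': "b = 2 ^ Suc c" by (simp add: h b)
  show "(\<And>t. t < k \<Longrightarrow> \<epsilon> t \<in> {0, 1}) \<Longrightarrow>
      odd_binomial X ((h - 1) * (\<Sum>t<k. \<epsilon> t * b ^ t)) \<longleftrightarrow>
      (\<exists>d. (\<forall>t<k. 0 \<le> d t \<and> d t \<le> (h - 1) * \<epsilon> t) \<and> X = (\<Sum>t<k. d t * b ^ t))"
    unfolding b' h by (rule odd_binomial_digits) auto
  show "odd_binomial X (\<Sum>t<k. b ^ t) \<longleftrightarrow>
      (\<exists>d. (\<forall>t<k. 0 \<le> d t \<and> d t \<le> 1) \<and> X = (\<Sum>t<k. d t * b ^ t))"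
    using odd_binomial_digits[of 1 "Suc c" k "\<lambda>_. 1" X] unfolding b' by simp
qed

text \<open>The parity conditions provide digits for the unknowns. The bounds by \<open>h\<close>
  keep all digit differences below the base \<open>2 * h\<close>, so that each equation between
  numbers holds digit by digit.\<close>

lemma equations_trace:
  assumes regs: "\<And>p. p < length prog \<Longrightarrow> register (prog ! p) < m"
    and h: "h = 2 ^ c" and eqs: "equations prog m (int x) h ((2 * h) ^ k) U F G R f"
  obtains F' G' R' where "trace prog m x k F' G' R'"
proof -
  let ?L = "length prog"
  define b where "b = 2 * h"
  note digits = odd_binomial_power_digits[OF h b_def]
  have h1: "h \<ge> 1" by (simp add: h)
  then have b: "b > 1" "b > 0" by (simp_all add: b_def)
  have U: "U = (\<Sum>t<k. b ^ t)"
    using eqs repunit_eq_iff[OF b(1)] unfolding equations_def b_def by blast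
  have xb: "int x < b" and Lh: "int ?L < h"
    using eqs unfolding equations_def b_def by blast+
  have F: "odd_binomial (F p) U" "odd_binomial (G p) U"
    "F p + G p = (if p = 0 then 1 else 0) + b * flow prog F G p" if "p < ?L" for p
    using eqs that unfolding equations_def b_def by blast+
  have dec: "odd_binomial (R (register (prog ! p))) ((h - 1) * (U - G p))" if "p < ?L" "is_dec (prog ! p)" for p
    using eqs that unfolding equations_def by presburger
  have inc: "G p = 0" if "p < ?L" "\<not> is_dec (prog ! p)" for p
    using eqs that unfolding equations_def by presburger
  have sum: "(\<Sum>p<?L. F p + G p) = U"
    using eqs unfolding equations_def by blast
  have R: "odd_binomial (R j) ((h - 1) * U)" "0 \<le> f j"
    "R j + f j * b ^ k = (if j = 0 then int x else 0) + b * (R j + change prog F j)" if "j < m" for j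
    using eqs that unfolding equations_def b_def by blast+
  have "\<forall>p<?L. \<exists>d. (\<forall>t<k. 0 \<le> d t \<and> d t \<le> 1) \<and> F p = (\<Sum>t<k. d t * b ^ t)"
    using F(1) unfolding U digits(2) by blast
  then obtain F' where F': "\<And>p t. p < ?L \<Longrightarrow> t < k \<Longrightarrow> 0 \<le> F' p t \<and> F' p t \<le> 1"
    "\<And>p. p < ?L \<Longrightarrow> F p = (\<Sum>t<k. F' p t * b ^ t)" by metis
  have "\<forall>p<?L. \<exists>d. (\<forall>t<k. 0 \<le> d t \<and> d t \<le> 1) \<and> G p = (\<Sum>t<k. d t * b ^ t)"
    using F(2) unfolding U digits(2) by blast
  then obtain G' where G': "\<And>p t. p < ?L \<Longrightarrow> t < k \<Longrightarrow> 0 \<le> G' p t \<and> G' p t \<le> 1"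
    "\<And>p. p < ?L \<Longrightarrow> G p = (\<Sum>t<k. G' p t * b ^ t)" by metis
  have "\<forall>j<m. \<exists>d. (\<forall>t<k. 0 \<le> d t \<and> d t \<le> h - 1) \<and> R j = (\<Sum>t<k. d t * b ^ t)"
    using R(1) digits(1)[of k "\<lambda>_. 1"] unfolding U by simp
  then obtain R' where R': "\<And>j t. j < m \<Longrightarrow> t < k \<Longrightarrow> 0 \<le> R' j t \<and> R' j t \<le> h - 1"
    "\<And>j. j < m \<Longrightarrow> R j = (\<Sum>t<k. R' j t * b ^ t)" by metis
  have flow_eq: "flow prog F G p = (\<Sum>t<k. flow prog (\<lambda>p. F' p t) (\<lambda>p. G' p t) p * b ^ t)" for p
  proof -
    have "flow prog F G p = flow prog (\<lambda>p. \<Sum>t<k. F' p t * b ^ t) (\<lambda>p. \<Sum>t<k. G' p t * b ^ t) p"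
      unfolding flow_def by (rule sum.cong) (simp_all add: F'(2) G'(2))
    then show ?thesis unfolding flow_digits .
  qed
  have change_eq: "change prog F j = (\<Sum>t<k. change prog (\<lambda>p. F' p t) j * b ^ t)" for j
  proof -
    have "change prog F j = change prog (\<lambda>p. \<Sum>t<k. F' p t * b ^ t) j"
      unfolding change_def by (rule sum.cong) (simp_all add: F'(2))
    then show ?thesis unfolding change_digits .
  qed
  have one: "(\<Sum>p<?L. F' p t + G' p t) = 1" if t: "t < k" for t
  proof -
    have "(\<Sum>p<?L. F p + G p) = (\<Sum>p<?L. \<Sum>t<k. (F' p t + G' p t) * b ^ t)"
      by (rule sum.cong) (simp_all add: F'(2) G'(2) sum.distrib distrib_right)
    also have "\<dots> = (\<Sum>t<k. (\<Sum>p<?L. F' p t + G' p t) * b ^ t)"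
      unfolding sum_distrib_right by (rule sum.swap)
    \<comment> \<open>The column sums minus 1 appear as digits of 0; being smaller than the base,
      they all vanish.\<close>
    finally have eq: "(\<Sum>t<k. ((\<Sum>p<?L. F' p t + G' p t) - 1) * b ^ t) + 0 * b ^ k = 0"
      using sum unfolding U by (simp add: left_diff_distrib sum_subtractf)
    have bd: "\<bar>(\<Sum>p<?L. F' p t + G' p t) - 1\<bar> < b" if "t < k" for t
    proof -
      have "0 \<le> (\<Sum>p<?L. F' p t + G' p t)"
        using F'(1) G'(1) that by (intro sum_nonneg) fastforce
      moreover have "(\<Sum>p<?L. F' p t + G' p t) \<le> (\<Sum>p<?L. 2)"
        using F'(1) G'(1) that by (intro sum_mono) fastforce
      ultimately show ?thesis using Lh b(1) by (simp add: b_def)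
    qed
    from small_digits_zero[OF eq bd b(2)] t show ?thesis by auto
  qed
  \<comment> \<open>The values at time \<open>k\<close> are the coefficients of
    \<open>b ^ k\<close>: no flag is set, as the program has been left, and register
    \<open>j\<close> holds \<open>f j\<close>.\<close>
  define FF where "FF p t = (if t < k then F' p t else 0)" for p t
  define GG where "GG p t = (if t < k then G' p t else 0)" for p t
  define RR where "RR j t = (if t < k then R' j t else f j)" for j t
  have pc: "FF p 0 + GG p 0 = (if p = 0 then 1 else 0)"
      "t < k \<Longrightarrow> FF p (Suc t) + GG p (Suc t) = flow prog (\<lambda>p. F' p t) (\<lambda>p. G' p t) p"
    if p: "p < ?L" for p t
  proof -
    have h2: "h \<ge> 2" using Lh p by linarith
    have small: "0 \<le> FF p t" "FF p t \<le> 1" "0 \<le> GG p t" "GG p t \<le> 1" for t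
      using F'(1)[OF p] G'(1)[OF p] by (auto simp: FF_def GG_def)
    have eq: "(\<Sum>t<k. (FF p t + GG p t) * b ^ t) + (FF p k + GG p k) * b ^ k =
        (if p = 0 then 1 else 0) + b * (\<Sum>t<k. flow prog (\<lambda>p. F' p t) (\<lambda>p. G' p t) p * b ^ t)"
      using F(3)[OF p] unfolding flow_eq F'(2)[OF p] G'(2)[OF p]
      by (simp add: FF_def GG_def sum.distrib distrib_right)
    have b0: "\<bar>(FF p 0 + GG p 0) - (if p = 0 then 1 else 0)\<bar> < b"
      using small[of 0] h2 by (auto simp: b_def)
    have bS: "\<bar>(FF p (Suc t) + GG p (Suc t)) - flow prog (\<lambda>p. F' p t) (\<lambda>p. G' p t) p\<bar> < b" if "Suc t < k" for t
    proof -
      have "0 \<le> flow prog (\<lambda>p. F' p t) (\<lambda>p. G' p t) p"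
        "flow prog (\<lambda>p. F' p t) (\<lambda>p. G' p t) p \<le> 2 * int ?L"
        using F'(1) G'(1) that by (intro flow_bounds; simp)+
      then show ?thesis using small[of "Suc t"] h2 Lh by (auto simp: b_def)
    qed
    show "FF p 0 + GG p 0 = (if p = 0 then 1 else 0)"
      by (rule shifted_digits(1)[OF eq b0 bS b(2)])
    show "t < k \<Longrightarrow> FF p (Suc t) + GG p (Suc t) = flow prog (\<lambda>p. F' p t) (\<lambda>p. G' p t) p"
      by (rule shifted_digits(2)[OF eq b0 bS b(2)])
  qed
  have reg: "RR j 0 = (if j = 0 then int x else 0)"
      "t < k \<Longrightarrow> RR j (Suc t) = R' j t + change prog (\<lambda>p. F' p t) j"
    if j: "j < m" for j t
  proof -
    have eq: "(\<Sum>t<k. RR j t * b ^ t) + RR j k * b ^ k =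
        (if j = 0 then int x else 0) + b * (\<Sum>t<k. (R' j t + change prog (\<lambda>p. F' p t) j) * b ^ t)"
      using R(3)[OF j] unfolding change_eq R'(2)[OF j]
      by (simp add: RR_def sum.distrib distrib_right)
    have b0: "\<bar>RR j 0 - (if j = 0 then int x else 0)\<bar> < b" if "k > 0"
      using R'(1)[OF j that] xb that h1 by (auto simp: RR_def b_def)
    have bS: "\<bar>RR j (Suc t) - (R' j t + change prog (\<lambda>p. F' p t) j)\<bar> < b" if "Suc t < k" for t
    proof -
      have "\<bar>change prog (\<lambda>p. F' p t) j\<bar> \<le> int ?L"
        using F'(1) that by (intro change_bound) simp
      then show ?thesis
        using R'(1)[OF j that] R'(1)[OF j, of t] that Lh by (auto simp: RR_def b_def)
    qed
    show "RR j 0 = (if j = 0 then int x else 0)"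
      by (rule shifted_digits(1)[OF eq b0 bS b(2)])
    show "t < k \<Longrightarrow> RR j (Suc t) = R' j t + change prog (\<lambda>p. F' p t) j"
      by (rule shifted_digits(2)[OF eq b0 bS b(2)])
  qed
  have G0: "G' p t = 0" if "p < ?L" "t < k" "\<not> is_dec (prog ! p)" for p t
  proof -
    have eq: "(\<Sum>t<k. G' p t * b ^ t) + 0 * b ^ k = 0"
      using inc G'(2) that by simp
    have bd: "\<bar>G' p t\<bar> < b" if "t < k" for t
      using G'(1)[OF \<open>p < ?L\<close> that] b(1) by simp
    from small_digits_zero[OF eq bd b(2)] that(2) show ?thesis by blast
  qed
  have R0: "R' (register (prog ! p)) t = 0" if p: "p < ?L" "t < k" "is_dec (prog ! p)" "G' p t = 1" for p t
  proof -
    let ?r = "register (prog ! p)"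
    have "U - G p = (\<Sum>t<k. (1 - G' p t) * b ^ t)"
      unfolding U G'(2)[OF p(1)] by (simp add: left_diff_distrib sum_subtractf)
    moreover have "1 - G' p t \<in> {0, 1}" if "t < k" for t
      using G'(1)[OF p(1) that] by auto
    ultimately obtain d where d: "\<And>t. t < k \<Longrightarrow> 0 \<le> d t \<and> d t \<le> (h - 1) * (1 - G' p t)"
      "R ?r = (\<Sum>t<k. d t * b ^ t)"
      using dec[OF p(1,3)] digits(1)[of k "\<lambda>t. 1 - G' p t" "R ?r"] by auto
    have r: "?r < m" using regs p(1) by blast
    \<comment> \<open>The two expansions of the register agree digit by digit, and the second has
      digit 0 wherever the zero branch is taken.\<close>
    have eq: "(\<Sum>t<k. (R' ?r t - d t) * b ^ t) + 0 * b ^ k = 0"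
      using d(2) R'(2)[OF r] by (simp add: left_diff_distrib sum_subtractf)
    have bd: "\<bar>R' ?r t - d t\<bar> < b" if t: "t < k" for t
    proof -
      have "(h - 1) * (1 - G' p t) \<le> (h - 1) * 1"
        using G'(1)[OF p(1) t] h1 by (intro mult_left_mono) auto
      then show ?thesis using d(1)[OF t] R'(1)[OF r t] h1 by (auto simp: b_def)
    qed
    from small_digits_zero[OF eq bd b(2)] have "R' ?r t = d t" using p(2) by auto
    then show ?thesis using d(1)[OF p(2)] p(4) by simp
  qed
  have "trace prog m x k FF GG RR"
  proof
    show "FF p (Suc t) + GG p (Suc t) = flow prog (\<lambda>p. FF p t) (\<lambda>p. GG p t) p" if "p < ?L" "t < k" for p t
      using pc(2)[OF that] that(2) by (simp add: FF_def GG_def)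
    show "RR j (Suc t) = RR j t + change prog (\<lambda>p. FF p t) j" if "j < m" "t < k" for j t
      using reg(2)[OF that] that(2) by (simp add: FF_def RR_def)
    show "FF p t \<in> {0, 1} \<and> GG p t \<in> {0, 1}" if "p < ?L" "t < k" for p t
      using F'(1)[OF that] G'(1)[OF that] that(2) by (auto simp: FF_def GG_def)
  qed (use pc(1) reg(1) one R'(1) R(2) G0 R0 in \<open>auto simp: FF_def GG_def RR_def\<close>)
  then show thesis by (rule that)
qed

lemma (in trace) equations:
  assumes regs: "\<And>p. p < length prog \<Longrightarrow> register (prog ! p) < m"
  obtains c h U F' G' R' f where "h = 2 ^ c" "equations prog m (int x) h ((2 * h) ^ k) U F' G' R' f"
proof -
  let ?L = "length prog"
  \<comment> \<open>A sum bounds each of its summands and \<open>c < 2 ^ c\<close>; thus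
    \<open>h\<close> exceeds the input, the length of the program and all register contents before
    time \<open>k\<close>.\<close>
  define c where "c = x + ?L + (\<Sum>j<m. \<Sum>t<k. nat (R j t))"
  define h where "h = (2::int) ^ c"
  define b where "b = 2 * h"
  note digits = odd_binomial_power_digits[OF h_def b_def]
  have ch: "int c < h"
    unfolding h_def by (metis less_exp of_nat_less_iff of_nat_numeral of_nat_power)
  then have b: "b > 1" by (simp add: b_def)
  have Rh: "R j t \<le> h - 1" if "j < m" "t < k" for j t
  proof -
    have "nat (R j t) \<le> (\<Sum>t<k. nat (R j t))"
      using that by (intro member_le_sum) auto
    also have "\<dots> \<le> (\<Sum>j<m. \<Sum>t<k. nat (R j t))"
      using that by (intro member_le_sum[of j "{..<m}" "\<lambda>j. \<Sum>t<k. nat (R j t)"]) auto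
    also have "\<dots> \<le> c" by (simp add: c_def)
    finally show ?thesis using ch by linarith
  qed
  define U where "U = (\<Sum>t<k. b ^ t)"
  let ?n = "\<lambda>H p. \<Sum>t<k. H p t * b ^ t :: int"
  have "equations prog m (int x) h (b ^ k) U (?n F) (?n G) (?n R) (\<lambda>j. R j k)"
    unfolding equations_def b_def[symmetric]
  proof (intro conjI allI impI)
    show "U * (b - 1) = b ^ k - 1"
      unfolding repunit_eq_iff[OF b] U_def ..
    have "x \<le> c" "?L \<le> c" by (simp_all add: c_def)
    then show "int x < b" "int ?L < h" using ch unfolding b_def by linarith+
    show "(\<Sum>p<?L. ?n F p + ?n G p) = U"
    proof -
      have "(\<Sum>p<?L. ?n F p + ?n G p) = (\<Sum>p<?L. \<Sum>t<k. (F p t + G p t) * b ^ t)"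
        by (simp add: sum.distrib distrib_right)
      also have "\<dots> = (\<Sum>t<k. (\<Sum>p<?L. F p t + G p t) * b ^ t)"
        unfolding sum_distrib_right by (rule sum.swap)
      finally show ?thesis by (simp add: one U_def)
    qed
  next
    fix p assume p: "p < ?L"
    show "odd_binomial (?n F p) U" "odd_binomial (?n G p) U"
      unfolding U_def digits(2) using branch[OF p]
      by (intro exI[of _ "F p"] exI[of _ "G p"]; force)+
    \<comment> \<open>A further digit at \<open>k\<close>, which is 0 because the run has left the
      program, makes the sum long enough to be split at its lowest digit and shifted.\<close>
    have "?n F p + ?n G p = (\<Sum>t<Suc k. (F p t + G p t) * b ^ t)"
      using halted[OF p] by (simp add: sum.distrib distrib_right)
    also have "\<dots> = (F p 0 + G p 0) + b * (\<Sum>t<k. (F p (Suc t) + G p (Suc t)) * b ^ t)"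
      by (rule sum_power_shift)
    also have "\<dots> = (if p = 0 then 1 else 0) + b * flow prog (?n F) (?n G) p"
      unfolding flow_digits using pc_0[OF p] pc_Suc[OF p] by simp
    finally show "?n F p + ?n G p = (if p = 0 then 1 else 0) + b * flow prog (?n F) (?n G) p" .
    show "if is_dec (prog ! p) then odd_binomial (?n R (register (prog ! p))) ((h - 1) * (U - ?n G p))
        else ?n G p = 0"
    proof (cases "is_dec (prog ! p)")
      case True
      let ?r = "register (prog ! p)"
      have "U - ?n G p = (\<Sum>t<k. (1 - G p t) * b ^ t)"
        unfolding U_def by (simp add: left_diff_distrib sum_subtractf)
      moreover have "odd_binomial (?n R ?r) ((h - 1) * (\<Sum>t<k. (1 - G p t) * b ^ t))"
      proof (rule iffD2[OF digits(1)])
        show "\<exists>d. (\<forall>t<k. 0 \<le> d t \<and> d t \<le> (h - 1) * (1 - G p t)) \<and> ?n R ?r = (\<Sum>t<k. d t * b ^ t)"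
        proof (intro exI[of _ "R ?r"] conjI allI impI)
          fix t assume t: "t < k"
          show "0 \<le> R ?r t" using reg_nonneg[OF regs[OF p]] t by simp
          show "R ?r t \<le> (h - 1) * (1 - G p t)"
            using branch[OF p t] zero_test[OF p t True] Rh[OF regs[OF p] t] by auto
        qed simp
      qed (use branch[OF p] in auto)
      ultimately show ?thesis using True by simp
    next
      case False
      then show ?thesis using inc[OF p] by simp
    qed
  next
    fix j assume j: "j < m"
    show "odd_binomial (?n R j) ((h - 1) * U)"
      using digits(1)[of k "\<lambda>_. 1" "?n R j"] Rh[OF j] reg_nonneg[OF j]
      unfolding U_def by (auto intro!: exI[of _ "R j"])
    show "0 \<le> R j k" using reg_nonneg[OF j] by simp
    have "?n R j + R j k * b ^ k = (\<Sum>t<Suc k. R j t * b ^ t)" by simp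
    also have "\<dots> = R j 0 + b * (\<Sum>t<k. R j (Suc t) * b ^ t)" by (rule sum_power_shift)
    also have "\<dots> = (if j = 0 then int x else 0) + b * (?n R j + change prog (?n F) j)"
      unfolding change_digits using reg_0[OF j] reg_Suc[OF j] by (simp add: sum.distrib distrib_right)
    finally show "?n R j + R j k * b ^ k = (if j = 0 then int x else 0) + b * (?n R j + change prog (?n F) j)" .
  qed
  then show thesis using that[OF h_def] unfolding b_def by blast
qed

section \<open>Undecidability\<close>

text \<open>The condition \<open>c\<close> is independent of \<open>v\<close>: it is decided by the
  program, not by the unknowns.\<close>

lemma int_poly_if: "int_poly K f \<Longrightarrow> int_poly K g \<Longrightarrow> int_poly K (\<lambda>v. if c then f v else g v)"
  by (cases c) simp_all

lemma expressible_if: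
  "expressible K P \<Longrightarrow> expressible K Q \<Longrightarrow> expressible K (\<lambda>x v. if c then P x v else Q x v)"
  by (cases c) simp_all

lemma halting_expressible:
  obtains K P where "expressible K P" "\<And>x. halts prog x \<longleftrightarrow> (\<exists>v. P x v)"
proof -
  let ?L = "length prog"
  \<comment> \<open>The sum is at least each register index, so \<open>m\<close> registers cover the
    program.\<close>
  define m where "m = Suc (sum_list (map register prog))"
  have regs: "register (prog ! p) < m" if "p < ?L" for p
    using member_le_sum_list[of "register (prog ! p)" "map register prog"] that
    by (simp add: m_def less_Suc_eq_le)
  define K where "K = 6 + 2 * ?L + 2 * m"
  \<comment> \<open>Coordinate 0 is the input, 1 the exponent \<open>c\<close> of \<open>h\<close>,
    2 the number \<open>k\<close> of steps, and 3 to 5 are \<open>h\<close>, \<open>B\<close>,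
    \<open>U\<close>. Then follow \<open>?L\<close> coordinates each for \<open>F\<close> and
    \<open>G\<close>, and \<open>m\<close> each for \<open>R\<close> and \<open>f\<close>. As
    \<open>2 * h = 2 ^ (c + 1)\<close>, the condition on coordinate 4 says
    \<open>B = (2 * h) ^ k\<close>.\<close>
  define P where "P x v \<longleftrightarrow> v 0 = int x \<and> (0 \<le> v 1 \<and> v 3 = 2 ^ nat (v 1)) \<and> 0 \<le> v 2 \<and>
     (0 \<le> (v 1 + 1) * v 2 \<and> v 4 = 2 ^ nat ((v 1 + 1) * v 2)) \<and>
     equations prog m (v 0) (v 3) (v 4) (v 5) (\<lambda>p. v (6 + p)) (\<lambda>p. v (6 + ?L + p))
       (\<lambda>j. v (6 + 2 * ?L + j)) (\<lambda>j. v (6 + 2 * ?L + m + j))"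
    for x :: nat and v :: "nat \<Rightarrow> int"
  have "expressible K P"
    unfolding P_def equations_def flow_def change_def K_def
    by (intro expressible_conj expressible_all_less expressible_if expressible_odd_binomial
        expressible_checkable checkable_power2 checkable_input checkable_eq checkable_le checkable_less
        int_poly_if int_poly_intros)
      (use regs in \<open>auto dest: regs\<close>)
  moreover have "halts prog x \<longleftrightarrow> (\<exists>v. P x v)" for x
  proof
    assume "halts prog x"
    then obtain k F G R where tr: "trace prog m x k F G R" by (rule halts_trace)
    obtain c h U F' G' R' f where h: "h = 2 ^ c" and
      eqs: "equations prog m (int x) h ((2 * h) ^ k) U F' G' R' f"
      by (rule trace.equations[OF tr regs])
    define v where "v i = (if i < 6 then [int x, int c, int k, h, (2 * h) ^ k, U] ! i
      else if i < 6 + ?L then F' (i - 6) else if i < 6 + 2 * ?L then G' (i - 6 - ?L)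
      else if i < 6 + 2 * ?L + m then R' (i - 6 - 2 * ?L) else f (i - 6 - 2 * ?L - m))" for i
    have v: "v 0 = int x" "v 1 = int c" "v 2 = int k" "v 3 = h" "v 4 = (2 * h) ^ k" "v 5 = U"
      by (simp_all add: v_def)
    have "equations prog m (int x) h ((2 * h) ^ k) U (\<lambda>p. v (6 + p)) (\<lambda>p. v (6 + ?L + p))
       (\<lambda>j. v (6 + 2 * ?L + j)) (\<lambda>j. v (6 + 2 * ?L + m + j))"
    proof -
      have FG: "v (6 + p) = F' p" "v (6 + ?L + p) = G' p" if "p < ?L" for p
        using that by (simp_all add: v_def)
      have "flow prog (\<lambda>p. v (6 + p)) (\<lambda>p. v (6 + ?L + p)) i = flow prog F' G' i" for i
        unfolding flow_def by (rule sum.cong) (simp_all add: FG)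
      moreover have "change prog (\<lambda>p. v (6 + p)) j = change prog F' j" for j
        unfolding change_def by (rule sum.cong) (simp_all add: FG)
      moreover have "(\<Sum>p<?L. F' p + G' p) = U"
        using eqs unfolding equations_def by blast
      then have sum: "(\<Sum>p<?L. v (6 + p) + v (6 + ?L + p)) = U"
        by (simp add: FG)
      moreover have "v (6 + 2 * ?L + j) = R' j" "v (6 + 2 * ?L + m + j) = f j" if "j < m" for j
        using that by (simp_all add: v_def)
      ultimately show ?thesis
        using eqs regs FG unfolding equations_def sum by simp
    qed
    moreover have "(2 * h) ^ k = 2 ^ nat ((int c + 1) * int k)"
    proof -
      have "(int c + 1) * int k = int (Suc c * k)" by (simp add: algebra_simps)
      moreover have "2 * h = 2 ^ Suc c" by (simp add: h)
      ultimately show ?thesis by (simp only: nat_int power_mult)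
    qed
    ultimately have "P x v"
      unfolding P_def v using h by simp
    then show "\<exists>v. P x v" by blast
  next
    assume "\<exists>v. P x v"
    then obtain v where v: "P x v" by blast
    then have v': "v 0 = int x" "0 \<le> v 1" "v 3 = 2 ^ nat (v 1)" "0 \<le> v 2"
      "v 4 = 2 ^ nat ((v 1 + 1) * v 2)"
      unfolding P_def by blast+
    obtain c where c: "v 1 = int c" using v'(2) by (rule nonneg_int_cases)
    obtain k where k: "v 2 = int k" using v'(4) by (rule nonneg_int_cases)
    have h: "v 3 = 2 ^ c" using v'(3) by (simp only: c nat_int)
    have "(int c + 1) * int k = int (Suc c * k)" by (simp add: algebra_simps)
    moreover have "2 * v 3 = 2 ^ Suc c" by (simp add: h)
    moreover have "v 4 = 2 ^ nat ((int c + 1) * int k)" using v'(5) by (simp only: c k)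
    ultimately have "v 4 = (2 * v 3) ^ k" by (simp only: nat_int power_mult)
    moreover have "equations prog m (v 0) (v 3) (v 4) (v 5) (\<lambda>p. v (6 + p)) (\<lambda>p. v (6 + ?L + p))
       (\<lambda>j. v (6 + 2 * ?L + j)) (\<lambda>j. v (6 + 2 * ?L + m + j))"
      using v unfolding P_def by blast
    ultimately have eqs: "equations prog m (int x) (v 3) ((2 * v 3) ^ k) (v 5) (\<lambda>p. v (6 + p)) (\<lambda>p. v (6 + ?L + p))
       (\<lambda>j. v (6 + 2 * ?L + j)) (\<lambda>j. v (6 + 2 * ?L + m + j))"
      by (simp only: v'(1))
    obtain F G R where "trace prog m x k F G R"
      by (rule equations_trace[OF regs h eqs])
    then show "halts prog x"
      by (rule trace.halts[OF _ regs])
  qed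
  ultimately show thesis by (rule that)
qed

theorem theorem2:
  shows "\<not> (\<exists>prog :: instr list.
           \<forall>(N::nat) (m::nat) (A :: rat mat) (Ps :: rat_mpoly list).
             N \<ge> 1 \<and> m \<ge> 1 \<and> A \<in> carrier_mat N N \<and> length Ps = m \<and> set Ps \<subseteq> mpolys_in N \<longrightarrow>
             rm_computes prog (loop_encode N A Ps)
               (if loop_terminating_over_int N A Ps then 1 else 0))"
proof
  assume "\<exists>prog :: instr list.
           \<forall>(N::nat) (m::nat) (A :: rat mat) (Ps :: rat_mpoly list).
             N \<ge> 1 \<and> m \<ge> 1 \<and> A \<in> carrier_mat N N \<and> length Ps = m \<and> set Ps \<subseteq> mpolys_in N \<longrightarrow>
             rm_computes prog (loop_encode N A Ps)
               (if loop_terminating_over_int N A Ps then 1 else 0)"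
  then obtain prog where prog: "\<And>N A Ps. N \<ge> 1 \<Longrightarrow> length Ps \<ge> 1 \<Longrightarrow> A \<in> carrier_mat N N \<Longrightarrow>
      set Ps \<subseteq> mpolys_in N \<Longrightarrow>
      rm_computes prog (loop_encode N A Ps) (if loop_terminating_over_int N A Ps then 1 else 0)"
    by blast
  obtain K P where P: "expressible K P" and halts: "\<And>x. halts (diagonal prog) x \<longleftrightarrow> (\<exists>v. P x v)"
    using halting_expressible[of "diagonal prog"] by blast
  obtain M Q where Q: "checkable M Q" and PQ: "\<And>x v. P x v \<longleftrightarrow> (\<exists>w. (\<forall>i<K. w i = v i) \<and> Q x w)"
    using P unfolding expressible_def by blast
  obtain Ps where Ps: "length Ps \<ge> 1" "set Ps \<subseteq> mpolys_in (5 + M)"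
    and loop: "\<And>x. loop_terminating_over_int (5 + M) (loop_mat (5 + M) x) Ps \<longleftrightarrow> \<not> (\<exists>v. Q x v)"
    using checkable_loop[OF Q] by blast
  \<comment> \<open>The guards are fixed before \<open>x\<close> is chosen, so there is an
    \<open>x\<close> whose completion by \<open>fill\<close> is the code of the loop with that same
    \<open>x\<close>.\<close>
  obtain x where x: "fill x = loop_encode (5 + M) (loop_mat (5 + M) x) Ps"
    using fill_loop_encode[of "5 + M" Ps] by auto
  have "rm_computes prog (fill x)
      (if loop_terminating_over_int (5 + M) (loop_mat (5 + M) x) Ps then 1 else 0)"
    unfolding x using Ps by (intro prog) auto
  \<comment> \<open>The machine halts on \<open>x\<close> iff the loop terminates, whereas the
    guards make the loop run forever on some input iff the machine halts.\<close>
  then have "halts (diagonal prog) x \<longleftrightarrow> loop_terminating_over_int (5 + M) (loop_mat (5 + M) x) Ps"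
    using halts_diagonal by force
  moreover have "(\<exists>v. P x v) \<longleftrightarrow> (\<exists>v. Q x v)"
    using PQ by blast
  ultimately show False
    using halts loop by blast
qed

end
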